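(* Fix an integer $k\ge 2$ and an integer $\ell\ge 1$, and let $\tilde{x}=(x_1,\ldots,x_\ell)$ and $y$ be variables. Then \[ \sum_{n\ge k}\tilde{\xi}^{\ell}_{\Pi_{n-1}(k-1)}(\tilde{x})\,\frac{y^n}{n!} =\frac{1}{S}\sum_{i=0}^{k-1}\frac{(x_1y)^i\bigl(e^{x_1y}-E_{k-i-1}(x_1y)\bigr)}{i!\,(e^{x_1y}-1)^{i+1}}\left(e^{\frac{S}{x_1}(e^{x_1y}-1)}-E_i\!\left(\frac{S}{x_1}(e^{x_1y}-1)\right)\right), \] where $S=x_2+\cdots+x_\ell+1$ (so $S=1$ when $\ell=1$) and $E_m(t)=1+t+\frac{t^2}{2!}+\cdots+\frac{t^m}{m!}$.
   Context: For $n\in\mathbb{N}$ and $F\subseteq[n]=\{1,\ldots,n\}$, let $\Delta_F=\{\tilde{x}\in\mathbb{R}^n: x_i\ge 0 \text{ for all } i,\ \sum_i x_i=1,\ x_i=0 \text{ for } i\notin F\}$. For $2\le k\le n$ define the polytope $\Pi_{n-1}(k-1)=\sum_{F\subseteq[n],|F|=k}\Delta_F$ (Minkowski sum); it has dimension $n-1$. For a $d$-dimensional polytope $P$ and a tuple $\tilde{s}=(s_1,\ldots,s_\ell)$ of integers with $0\le s_1\le\cdots\le s_\ell\le d$, $f_{\tilde{s}}(P)$ denotes the number of chains of faces $A_1\subseteq A_2\subseteq\cdots\subseteq A_\ell$ of $P$ with $\dim A_i=s_i$ for all $i$. Write $\tilde{x}^{\partial(\tilde{s})}=x_1^{s_1}x_2^{s_2-s_1}\cdots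 x_\ell^{s_\ell-s_{\ell-1}}$. The exponential $\ell$-flag polynomial of $P$ is $\tilde{\xi}^{\ell}_P(\tilde{x})=\sum_{\tilde{s}}\frac{f_{\tilde{s}}(P)}{(d-s_1+1)!}\tilde{x}^{\partial(\tilde{s})}$, the sum over all such $\tilde{s}$. The identity is one of generating functions in $y$ (the right-hand side expanded as a power series in $y$). *)

theory Defs
  imports "HOL-Analysis.Analysis" "HOL-Analysis.Finite_Function_Topology"
    "HOL-Computational_Algebra.Computational_Algebra"
begin

instance fract :: ("{idom,ring_char_0}") field_char_0
proof
  have "of_nat n = Fract (of_nat n) (1::'a)" for n
    by (induction n) (simp_all add: Zero_fract_def One_fract_def)
  then show "inj (of_nat :: nat \<Rightarrow> 'a fract)"
    by (auto intro!: injI simp: eq_fract)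
qed

text \<open>
  The dimension \<open>n\<close> varies within a single identity, so \<open>\<real>\<^sup>n\<close> is represented by the finitely
  supported functions \<open>nat \<Rightarrow>\<^sub>0 real\<close> whose support lies in \<open>{1..n}\<close>.
\<close>

definition simplex_face :: "nat \<Rightarrow> nat set \<Rightarrow> (nat \<Rightarrow>\<^sub>0 real) set" where
  "simplex_face n F =
     {x. Poly_Mapping.keys x \<subseteq> {1..n} \<and>
         (\<forall>i\<in>{1..n}. Poly_Mapping.lookup x i \<ge> 0) \<and>
         (\<Sum>i=1..n. Poly_Mapping.lookup x i) = 1 \<and>
         (\<forall>i\<in>{1..n} - F. Poly_Mapping.lookup x i = 0)}"

text \<open>
  \<open>Pi_polytope n k\<close> is \<open>\<Pi>\<^bsub>n-1\<^esub>(k-1)\<close>; the sum of sets is the Minkowski sum.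
\<close>

definition Pi_polytope :: "nat \<Rightarrow> nat \<Rightarrow> (nat \<Rightarrow>\<^sub>0 real) set" where
  "Pi_polytope n k = (\<Sum>F | F \<subseteq> {1..n} \<and> card F = k. simplex_face n F)"

text \<open>
  The library's \<^const>\<open>aff_dim\<close> is restricted to Euclidean spaces; this is the same notion
  on an arbitrary real vector space, with the empty set again getting dimension \<open>-1\<close>.
\<close>

definition affine_dim :: "'a::real_vector set \<Rightarrow> int" where
  "affine_dim A = (if A = {} then -1 else int (dim {a - b |a b. a \<in> A \<and> b \<in> A}))"

lemma affine_dim_eq_aff_dim:
  fixes A :: "'a::euclidean_space set"
  shows "affine_dim A = aff_dim A"
proof (cases "A = {}")
  case False
  then obtain c where c: "c \<in> A" by blast
  have sub: "(+) (- c) ` A \<subseteq> {a - b |a b. a \<in> A \<and> b \<in> A}"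
    using c by force
  have "a - b \<in> span ((+) (- c) ` A)" if "a \<in> A" "b \<in> A" for a b
  proof -
    have "(- c + a) - (- c + b) \<in> span ((+) (- c) ` A)"
      using that by (intro span_diff span_base) auto
    then show ?thesis by simp
  qed
  then have "{a - b |a b. a \<in> A \<and> b \<in> A} \<subseteq> span ((+) (- c) ` A)"
    by blast
  moreover have "(+) (- c) ` A \<subseteq> span {a - b |a b. a \<in> A \<and> b \<in> A}"
    using sub span_superset by (rule subset_trans)
  ultimately have "dim {a - b |a b. a \<in> A \<and> b \<in> A} = dim ((+) (- c) ` A)"
    by (intro span_eq_dim) (simp only: span_eq)
  moreover have "aff_dim A = int (dim ((+) (- c) ` A))"
    using c by (intro aff_dim_eq_dim hull_inc)
  ultimately show ?thesis
    using False by (simp add: affine_dim_def)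
qed (simp add: affine_dim_def)

definition flag_number :: "nat list \<Rightarrow> 'a::real_vector set \<Rightarrow> nat" where
  "flag_number s P =
     card {As. length As = length s \<and> sorted_wrt (\<subseteq>) As \<and>
               (\<forall>i<length s. As ! i face_of P \<and> affine_dim (As ! i) = int (s ! i))}"

type_synonym mpoly = "(nat \<Rightarrow>\<^sub>0 nat) \<Rightarrow>\<^sub>0 rat"

definition Const :: "rat \<Rightarrow> mpoly" where
  "Const c = Poly_Mapping.single 0 c"

definition Var :: "nat \<Rightarrow> mpoly" where
  "Var i = Poly_Mapping.single (Poly_Mapping.single i 1) 1"

text \<open>Tuples are \<open>0\<close>-indexed lists: \<open>s\<^sub>i\<close> is \<open>s ! (i - 1)\<close>.\<close>

definition flag_monomial :: "nat list \<Rightarrow> mpoly" where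
  "flag_monomial s =
     Var 1 ^ (s ! 0) * (\<Prod>i=2..length s. Var i ^ (s ! (i - 1) - s ! (i - 2)))"

definition exp_flag_poly :: "nat \<Rightarrow> 'a::real_vector set \<Rightarrow> mpoly" where
  "exp_flag_poly l P =
     (let d = nat (affine_dim P) in
      \<Sum>s | length s = l \<and> sorted s \<and> set s \<subseteq> {0..d}.
        Const (of_nat (flag_number s P) / fact (d - s ! 0 + 1)) * flag_monomial s)"

definition trunc_exp :: "nat \<Rightarrow> 'a::field_char_0 fps \<Rightarrow> 'a fps" where
  "trunc_exp m t = (\<Sum>j\<le>m. fps_const (1 / fact j) * t ^ j)"

end

theory Submission
  imports Defs
begin

text \<open>
  Let \<open>P\<close> be the polytope \<open>\<Pi>\<^bsub>n-1\<^esub>(k-1)\<close>. A point \<open>x\<close> of \<open>P\<close> satisfies \<open>x(A) \<ge> #{F \<subseteq> A. |F| = k}\<close> for every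
  \<open>A \<subseteq> [n]\<close>, and only sets \<open>A\<close> with \<open>|A| = 1\<close> or \<open>|A| \<ge> k\<close> matter. The sets that are tight at \<open>x\<close> consist
  of a chain of sets of size at least \<open>k\<close> ending in \<open>[n]\<close>, together with fewer than \<open>k\<close> singletons contained
  in all members of that chain; every such family \<open>\<A>\<close> occurs. This makes the nonempty faces of \<open>P\<close>
  correspond to these families, with inclusion reversed and with \<open>dim = n - |\<A>|\<close>. In particular
  the faces above a given face form a Boolean lattice (\<open>P\<close> is simple), so summing over the flags that
  start at \<open>\<A>\<close> gives \<open>S ^ (|\<A>| - 1)\<close> by the binomial theorem. Finally, the families with \<open>r\<close> singletons
  and \<open>m + 1\<close> large sets have the exponential generating function
  \<open>y\<^sup>r / r! \<cdot> (e\<^sup>y - E\<^bsub>k-r-1\<^esub>(y)) \<cdot> (e\<^sup>y - 1)\<^sup>m\<close>, and summation over \<open>m\<close> yields the tail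
  \<open>e\<^sup>T - E\<^sub>r(T)\<close> of the exponential series.
\<close>

unbundle no vec_syntax

section \<open>Nested families\<close>

text \<open>This is the combinatorial shape of the family of tight sets at a point. The condition on
  unions makes every member with at least \<open>k\<close> elements comparable to all members, so
  these large members form a chain, and each singleton member lies in all of them.\<close>

definition nested_family :: "nat \<Rightarrow> 'a set \<Rightarrow> 'a set set \<Rightarrow> bool" where
  "nested_family k X \<A> \<longleftrightarrow> finite X \<and> 2 \<le> k \<and> k \<le> card X \<and> X \<in> \<A> \<and>
     (\<forall>A\<in>\<A>. A \<subseteq> X \<and> (card A = 1 \<or> k \<le> card A)) \<and>
     (\<forall>A\<in>\<A>. \<forall>B\<in>\<A>. k \<le> card (A \<union> B) \<longrightarrow> A \<subseteq> B \<or> B \<subseteq> A) \<and>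
     card {i. {i} \<in> \<A>} < k"

lemma nested_familyD:
  assumes "nested_family k X \<A>"
  shows "finite X" "2 \<le> k" "k \<le> card X" "X \<in> \<A>" "card {i. {i} \<in> \<A>} < k"
    and "\<And>A. A \<in> \<A> \<Longrightarrow> A \<subseteq> X" "\<And>A. A \<in> \<A> \<Longrightarrow> finite A"
    and "\<And>A. A \<in> \<A> \<Longrightarrow> card A = 1 \<or> k \<le> card A"
    and "\<And>A B. A \<in> \<A> \<Longrightarrow> B \<in> \<A> \<Longrightarrow> k \<le> card (A \<union> B) \<Longrightarrow> A \<subseteq> B \<or> B \<subseteq> A"
    and "finite \<A>" "finite {i. {i} \<in> \<A>}"
proof -
  note a = assms[unfolded nested_family_def]
  show "finite X" "2 \<le> k" "k \<le> card X" "X \<in> \<A>" "card {i. {i} \<in> \<A>} < k"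
    and sub: "\<And>A. A \<in> \<A> \<Longrightarrow> A \<subseteq> X"
    and "\<And>A. A \<in> \<A> \<Longrightarrow> card A = 1 \<or> k \<le> card A"
    and "\<And>A B. A \<in> \<A> \<Longrightarrow> B \<in> \<A> \<Longrightarrow> k \<le> card (A \<union> B) \<Longrightarrow> A \<subseteq> B \<or> B \<subseteq> A"
    using a by blast+
  show "\<And>A. A \<in> \<A> \<Longrightarrow> finite A" using sub \<open>finite X\<close> finite_subset by blast
  show "finite \<A>" using sub \<open>finite X\<close> by (meson Pow_iff finite_Pow_iff finite_subset subsetI)
  have "{i. {i} \<in> \<A>} \<subseteq> X" using sub by blast
  then show "finite {i. {i} \<in> \<A>}" using \<open>finite X\<close> finite_subset by blast
qed

lemma nested_family_comparable:
  assumes "nested_family k X \<A>" "A \<in> \<A>" "B \<in> \<A>" "k \<le> card A"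
  shows "A \<subseteq> B \<or> B \<subseteq> A"
proof -
  have "card A \<le> card (A \<union> B)"
    using assms by (intro card_mono) (auto dest: nested_familyD(7))
  with assms show ?thesis using nested_familyD(9)[OF assms(1-3)] by linarith
qed

lemma nested_family_comparable_of_mem:
  assumes "nested_family k X \<A>" "A \<in> \<A>" "B \<in> \<A>" "i \<in> A" "i \<in> B"
  shows "A \<subseteq> B \<or> B \<subseteq> A"
proof -
  consider "k \<le> card A" | "k \<le> card B" | "card A = 1" "card B = 1"
    using nested_familyD(8)[OF assms(1)] assms(2,3) by blast
  then show ?thesis
  proof cases
    case 3
    then show ?thesis using assms(4,5) by (auto simp: card_1_singleton_iff)
  qed (use nested_family_comparable[OF assms(1)] assms in blast)+
qed

text \<open>All conditions on members pass to subfamilies. Hence the faces above a given face form a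
  Boolean lattice, which is what the flag count uses.\<close>

lemma nested_family_subset:
  assumes "nested_family k X \<A>" "\<B> \<subseteq> \<A>" "X \<in> \<B>"
  shows "nested_family k X \<B>"
proof -
  have "card {i. {i} \<in> \<B>} \<le> card {i. {i} \<in> \<A>}"
    using assms nested_familyD(11)[OF assms(1)] by (intro card_mono) auto
  then have "card {i. {i} \<in> \<B>} < k"
    using nested_familyD(5)[OF assms(1)] by linarith
  then show ?thesis
    using assms unfolding nested_family_def by (meson subsetD)
qed

lemma finite_chain_has_max:
  assumes "finite \<F>" "\<F> \<noteq> {}" "\<And>A B. A \<in> \<F> \<Longrightarrow> B \<in> \<F> \<Longrightarrow> A \<subseteq> B \<or> B \<subseteq> A"
  obtains L where "L \<in> \<F>" "\<And>A. A \<in> \<F> \<Longrightarrow> A \<subseteq> L"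
  using finite_has_maximal[OF assms(1,2)] assms(3) by (metis order_refl subset_antisym)

lemma finite_chain_has_min:
  assumes "finite \<F>" "\<F> \<noteq> {}" "\<And>A B. A \<in> \<F> \<Longrightarrow> B \<in> \<F> \<Longrightarrow> A \<subseteq> B \<or> B \<subseteq> A"
  obtains L where "L \<in> \<F>" "\<And>A. A \<in> \<F> \<Longrightarrow> L \<subseteq> A"
  using finite_has_minimal[OF assms(1,2)] assms(3) by (metis order_refl subset_antisym)

text \<open>If some member not containing \<open>Y\<close> is large, the largest such one contains
  all the others, singletons included. If all of them are singletons, there are fewer than
  \<open>k\<close>, too few to cover a large \<open>B\<close>. So a cover by many members reduces to
  a cover by one.\<close>

lemma nested_family_union_cover:
  assumes nf: "nested_family k X \<A>" and B: "card B = 1 \<or> k \<le> card B"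
    and sub: "B \<subseteq> \<Union>{A \<in> \<A>. \<not> Y \<subseteq> A}"
  shows "\<exists>A\<in>\<A>. \<not> Y \<subseteq> A \<and> B \<subseteq> A"
proof (cases "card B = 1")
  case True
  then obtain i where "B = {i}" by (auto simp: card_1_singleton_iff)
  then show ?thesis using sub by blast
next
  case False
  then have kB: "k \<le> card B" using B by blast
  define \<F> where "\<F> = {A \<in> \<A>. \<not> Y \<subseteq> A \<and> k \<le> card A}"
  note D = nested_familyD[OF nf]
  show ?thesis
  proof (cases "\<F> = {}")
    case True
    then have "card A = 1" if "A \<in> \<A>" "\<not> Y \<subseteq> A" for A
      using that D(8) unfolding \<F>_def by blast
    then have "B \<subseteq> {i. {i} \<in> \<A>}"
      using sub by (fastforce simp: card_1_singleton_iff)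
    then have "card B < k" using D(5,11) by (meson card_mono le_less_trans)
    then show ?thesis using kB by simp
  next
    case False
    have "finite \<F>" using D(10) by (simp add: \<F>_def)
    then obtain L where L: "L \<in> \<F>" "\<And>A. A \<in> \<F> \<Longrightarrow> A \<subseteq> L"
      using False by (rule finite_chain_has_max)
        (auto simp: \<F>_def dest: nested_family_comparable[OF nf])
    have "A \<subseteq> L" if "A \<in> \<A>" "\<not> Y \<subseteq> A" for A
    proof (cases "A \<in> \<F>")
      case False
      then have c: "card A = 1" using that D(8) by (auto simp: \<F>_def)
      have "\<not> L \<subseteq> A"
        using card_mono[of A L] c L(1) D(2,7) that by (auto simp: \<F>_def)
      then show ?thesis
        using nested_family_comparable[OF nf, of L A] L that by (auto simp: \<F>_def)
    qed (rule L(2))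
    then have "B \<subseteq> L" using sub by blast
    then show ?thesis using L by (auto simp: \<F>_def)
  qed
qed

section \<open>Least members and the blocks they cut out of the ground set\<close>

definition least_member :: "'a set set \<Rightarrow> 'a \<Rightarrow> 'a set" where
  "least_member \<A> i = \<Inter>{A \<in> \<A>. i \<in> A}"

lemma least_member:
  assumes nf: "nested_family k X \<A>" and "i \<in> X"
  shows "least_member \<A> i \<in> \<A>" "i \<in> least_member \<A> i"
    and "A \<in> \<A> \<Longrightarrow> i \<in> A \<longleftrightarrow> least_member \<A> i \<subseteq> A"
proof -
  note D = nested_familyD[OF nf]
  have "finite {A \<in> \<A>. i \<in> A}" "{A \<in> \<A>. i \<in> A} \<noteq> {}" using D(4,10) assms by auto
  then obtain L where L: "L \<in> {A \<in> \<A>. i \<in> A}" "\<And>A. A \<in> {A \<in> \<A>. i \<in> A} \<Longrightarrow> L \<subseteq> A"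
    by (rule finite_chain_has_min) (auto dest: nested_family_comparable_of_mem[OF nf])
  then have "least_member \<A> i = L" unfolding least_member_def by blast
  with L show "least_member \<A> i \<in> \<A>" "i \<in> least_member \<A> i"
    and "A \<in> \<A> \<Longrightarrow> i \<in> A \<longleftrightarrow> least_member \<A> i \<subseteq> A" by auto
qed

text \<open>Otherwise every point of \<open>A\<close> lies in a member not containing
  \<open>A\<close>, and by the covering lemma a single such member would contain \<open>A\<close>.
  Thus the members index nonempty blocks of the ground set, which later makes the dimension drop by
  exactly one per member.\<close>

lemma least_member_surj:
  assumes nf: "nested_family k X \<A>" and A: "A \<in> \<A>"
  shows "\<exists>i\<in>A. least_member \<A> i = A"
proof -
  note D = nested_familyD[OF nf]
  have "\<exists>i\<in>A. \<forall>B\<in>\<A>. i \<in> B \<longrightarrow> A \<subseteq> B"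
  proof (rule ccontr)
    assume "\<not> ?thesis"
    then have "A \<subseteq> \<Union>{B \<in> \<A>. \<not> A \<subseteq> B}" by blast
    then show False using nested_family_union_cover[OF nf] D(8)[OF A] by blast
  qed
  then obtain i where i: "i \<in> A" "\<And>B. B \<in> \<A> \<Longrightarrow> i \<in> B \<Longrightarrow> A \<subseteq> B" by blast
  then have "least_member \<A> i = A" using A unfolding least_member_def by blast
  then show ?thesis using i by blast
qed

lemma obtain_block_representatives:
  assumes nf: "nested_family k X \<A>"
  obtains b where "\<And>A. A \<in> \<A> \<Longrightarrow> b A \<in> X \<and> b A \<in> A \<and> least_member \<A> (b A) = A"
    "inj_on b \<A>"
proof -
  obtain b where b: "\<And>A. A \<in> \<A> \<Longrightarrow> b A \<in> A \<and> least_member \<A> (b A) = A"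
    using least_member_surj[OF nf] by metis
  have "inj_on b \<A>" using b by (metis inj_onI)
  moreover have "b A \<in> X \<and> b A \<in> A \<and> least_member \<A> (b A) = A" if "A \<in> \<A>" for A
    using b[OF that] nested_familyD(6)[OF nf that] by blast
  ultimately show ?thesis using that by blast
qed

text \<open>A member is the disjoint union of the blocks of the members inside it; by induction on
  size all blocks except its own contribute zero.\<close>

lemma nested_family_block_sum_zero:
  fixes v :: "'a \<Rightarrow> 'b::ab_group_add"
  assumes nf: "nested_family k X \<A>" and v: "\<And>A. A \<in> \<A> \<Longrightarrow> sum v A = 0" and "A \<in> \<A>"
  shows "(\<Sum>i | i \<in> X \<and> least_member \<A> i = A. v i) = 0"
  using \<open>A \<in> \<A>\<close>
proof (induction "card A" arbitrary: A rule: less_induct)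
  case less
  note D = nested_familyD[OF nf]
  define s where "s B = (\<Sum>i | i \<in> X \<and> least_member \<A> i = B. v i)" for B
  have fin: "finite {B \<in> \<A>. B \<subseteq> A}" using D(10) by simp
  have eq: "{i \<in> A. least_member \<A> i = B} = {i. i \<in> X \<and> least_member \<A> i = B}"
    if "B \<in> \<A>" "B \<subseteq> A" for B
    using that least_member[OF nf] D(6) less.prems by blast
  have "0 = sum v A" using v less.prems by simp
  also have "\<dots> = (\<Sum>B\<in>{B \<in> \<A>. B \<subseteq> A}. \<Sum>i\<in>{i \<in> A. least_member \<A> i = B}. v i)"
    by (rule sum.group[symmetric])
      (use fin D(6,7) less.prems least_member[OF nf] in blast)+
  also have "\<dots> = (\<Sum>B\<in>{B \<in> \<A>. B \<subseteq> A}. s B)"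
    by (intro sum.cong refl) (use eq in \<open>simp add: s_def\<close>)
  also have "\<dots> = s A + (\<Sum>B\<in>{B \<in> \<A>. B \<subseteq> A} - {A}. s B)"
    using fin less.prems by (subst sum.remove[of _ A]) auto
  also have "(\<Sum>B\<in>{B \<in> \<A>. B \<subseteq> A} - {A}. s B) = 0"
    by (intro sum.neutral ballI)
      (use less.hyps D(7)[OF less.prems] in \<open>auto simp: s_def intro!: psubset_card_mono\<close>)
  finally show ?case by (simp add: s_def)
qed

lemma obtain_subset_containing:
  assumes "finite C" "2 \<le> k" "k \<le> card C" "a \<in> C" "b \<in> C"
  obtains F where "F \<subseteq> C" "card F = k" "a \<in> F" "b \<in> F"
proof -
  have "card {a, b} \<le> k" using card_insert_le_m1[of 2 "{b}" a] assms(2) by (simp add: card_insert_if)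
  then obtain F where "{a, b} \<subseteq> F" "F \<subseteq> C" "card F = k"
    using exists_subset_between[of "{a,b}" k C] assms by auto
  then show ?thesis using that by blast
qed

section \<open>Tight sets\<close>

abbreviation "lookup \<equiv> Poly_Mapping.lookup"
abbreviation unit_vec :: "nat \<Rightarrow> nat \<Rightarrow>\<^sub>0 real" where "unit_vec i \<equiv> Poly_Mapping.single i 1"

lemma lookup_scaleR [simp]: "lookup (c *\<^sub>R x) i = c *\<^sub>R lookup x i"
proof -
  have "{i. c *\<^sub>R lookup x i \<noteq> 0} \<subseteq> Poly_Mapping.keys x" by (auto simp: in_keys_iff)
  then have "finite {i. c *\<^sub>R lookup x i \<noteq> 0}" by (rule finite_subset) simp
  then show ?thesis by (simp add: scaleR_poly_mapping_def)
qed

definition mass :: "('a \<Rightarrow>\<^sub>0 real) \<Rightarrow> 'a set \<Rightarrow> real" where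
  "mass x A = (\<Sum>i\<in>A. lookup x i)"

lemma mass_add: "mass (x + y) A = mass x A + mass y A"
  by (simp add: mass_def lookup_add sum.distrib)

lemma mass_diff: "mass (x - y) A = mass x A - mass y A"
  by (simp add: mass_def lookup_minus sum_subtractf)

lemma mass_scaleR: "mass (c *\<^sub>R x) A = c * mass x A"
  by (simp add: mass_def sum_distrib_left)

lemma mass_sum: "mass (\<Sum>j\<in>J. f j) A = (\<Sum>j\<in>J. mass (f j) A)"
  unfolding mass_def Poly_Mapping.lookup_sum by (rule sum.swap)

definition ksets :: "nat \<Rightarrow> nat \<Rightarrow> nat set set" where
  "ksets n k = {F. F \<subseteq> {1..n} \<and> card F = k}"

lemma ksetsD: "F \<in> ksets n k \<Longrightarrow> F \<subseteq> {1..n}" "F \<in> ksets n k \<Longrightarrow> card F = k"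
    "F \<in> ksets n k \<Longrightarrow> finite F"
  by (auto simp: ksets_def intro: finite_subset)

lemma finite_ksets [simp]: "finite (ksets n k)"
  by (simp add: ksets_def)

lemma simplex_face_iff:
  assumes "F \<subseteq> {1..n}"
  shows "p \<in> simplex_face n F \<longleftrightarrow>
    (\<forall>i. 0 \<le> lookup p i) \<and> (\<forall>i. i \<notin> F \<longrightarrow> lookup p i = 0) \<and> mass p F = 1"
proof -
  have m: "(\<Sum>i=1..n. lookup p i) = mass p F" if "\<And>i. i \<in> {1..n} - F \<Longrightarrow> lookup p i = 0"
    unfolding mass_def using assms that by (intro sum.mono_neutral_right) auto
  have z: "lookup p i = 0" if "Poly_Mapping.keys p \<subseteq> {1..n}" "i \<notin> {1..n}" for i
    using that by (meson in_keys_iff subsetD)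
  have "(\<forall>i. 0 \<le> lookup p i) \<and> (\<forall>i. i \<notin> F \<longrightarrow> lookup p i = 0) \<and> mass p F = 1"
    if "p \<in> simplex_face n F"
  proof -
    have *: "Poly_Mapping.keys p \<subseteq> {1..n}" "\<And>i. i \<in> {1..n} \<Longrightarrow> 0 \<le> lookup p i"
      "(\<Sum>i=1..n. lookup p i) = 1" "\<And>i. i \<in> {1..n} - F \<Longrightarrow> lookup p i = 0"
      using that unfolding simplex_face_def by blast+
    show ?thesis using * m[OF *(4)] z[OF *(1)]
      by (metis Diff_iff order_refl)
  qed
  moreover have "p \<in> simplex_face n F"
    if "\<forall>i. 0 \<le> lookup p i" "\<forall>i. i \<notin> F \<longrightarrow> lookup p i = 0" "mass p F = 1"
  proof -
    have "Poly_Mapping.keys p \<subseteq> {1..n}" using that(2) assms by (metis in_keys_iff subsetD subsetI)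
    then show ?thesis using that m by (auto simp: simplex_face_def)
  qed
  ultimately show ?thesis by blast
qed

text \<open>Keeps the summands of a point of the Minkowski sum in view: \<open>p F\<close> is the
  unit of mass that \<open>F\<close> distributes over its own elements.\<close>

definition decomposes :: "nat \<Rightarrow> nat \<Rightarrow> (nat set \<Rightarrow> nat \<Rightarrow>\<^sub>0 real) \<Rightarrow> (nat \<Rightarrow>\<^sub>0 real) \<Rightarrow> bool" where
  "decomposes n k p x \<longleftrightarrow> (\<forall>F\<in>ksets n k. p F \<in> simplex_face n F) \<and> x = (\<Sum>F\<in>ksets n k. p F)"

lemma Pi_polytope_iff: "x \<in> Pi_polytope n k \<longleftrightarrow> (\<exists>p. decomposes n k p x)"
proof -
  have "finite {F. F \<subseteq> {1..n} \<and> card F = k}" by simp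
  from set_sum_alt[OF this, of "simplex_face n"] show ?thesis
    unfolding Pi_polytope_def decomposes_def ksets_def by auto
qed

lemma decomposesD:
  assumes "decomposes n k p x" "F \<in> ksets n k"
  shows "0 \<le> lookup (p F) i" "i \<notin> F \<Longrightarrow> lookup (p F) i = 0" "mass (p F) F = 1"
  using assms simplex_face_iff[OF ksetsD(1)[OF assms(2)]] unfolding decomposes_def by auto

lemma mass_part_bound:
  assumes "decomposes n k p x" "F \<in> ksets n k" "finite A"
  shows "of_bool (F \<subseteq> A) \<le> mass (p F) A"
    and "mass (p F) A = of_bool (F \<subseteq> A) \<longleftrightarrow> (\<not> F \<subseteq> A \<longrightarrow> (\<forall>i\<in>A. lookup (p F) i = 0))"
proof -
  note d = decomposesD[OF assms(1,2)]
  have "mass (p F) A = 1" if "F \<subseteq> A"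
  proof -
    have "mass (p F) A = mass (p F) F"
      unfolding mass_def using that d(2) assms(3) by (intro sum.mono_neutral_right) auto
    with d show ?thesis by simp
  qed
  moreover have "0 \<le> mass (p F) A" unfolding mass_def using d(1) by (intro sum_nonneg) auto
  moreover have "mass (p F) A = 0 \<longleftrightarrow> (\<forall>i\<in>A. lookup (p F) i = 0)"
    unfolding mass_def using d(1) assms(3) by (intro sum_nonneg_eq_0_iff) auto
  ultimately show "of_bool (F \<subseteq> A) \<le> mass (p F) A"
    "mass (p F) A = of_bool (F \<subseteq> A) \<longleftrightarrow> (\<not> F \<subseteq> A \<longrightarrow> (\<forall>i\<in>A. lookup (p F) i = 0))"
    by auto
qed

definition num_ksets :: "nat \<Rightarrow> nat \<Rightarrow> nat set \<Rightarrow> real" where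
  "num_ksets n k A = (\<Sum>F\<in>ksets n k. of_bool (F \<subseteq> A))"

text \<open>Every \<open>F \<subseteq> A\<close> has all its unit mass inside \<open>A\<close>, and
  the other ones contribute a nonnegative amount. Equality therefore says that no \<open>F\<close>
  sticking out of \<open>A\<close> puts mass on \<open>A\<close>, which is the form in which
  tightness is used.\<close>

lemma mass_ge_num_ksets:
  assumes "decomposes n k p x" "finite A"
  shows "num_ksets n k A \<le> mass x A"
    and "mass x A = num_ksets n k A \<longleftrightarrow>
      (\<forall>F\<in>ksets n k. \<not> F \<subseteq> A \<longrightarrow> (\<forall>i\<in>A. lookup (p F) i = 0))"
proof -
  have x: "mass x A = (\<Sum>F\<in>ksets n k. mass (p F) A)"
    using assms(1) by (simp add: decomposes_def mass_sum)
  show "num_ksets n k A \<le> mass x A"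
    unfolding x num_ksets_def by (intro sum_mono mass_part_bound(1)[OF assms(1) _ assms(2)])
  have "mass x A = num_ksets n k A \<longleftrightarrow>
      (\<Sum>F\<in>ksets n k. mass (p F) A - of_bool (F \<subseteq> A)) = 0"
    unfolding x num_ksets_def by (simp only: sum_subtractf right_minus_eq)
  also have "\<dots> \<longleftrightarrow> (\<forall>F\<in>ksets n k. mass (p F) A - of_bool (F \<subseteq> A) = 0)"
    by (intro sum_nonneg_eq_0_iff finite_ksets) (use mass_part_bound[OF assms(1) _ assms(2)] in auto)
  also have "\<dots> \<longleftrightarrow> (\<forall>F\<in>ksets n k. \<not> F \<subseteq> A \<longrightarrow> (\<forall>i\<in>A. lookup (p F) i = 0))"
    unfolding right_minus_eq by (intro ball_cong refl mass_part_bound(2)[OF assms(1) _ assms(2)])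
  finally show "mass x A = num_ksets n k A \<longleftrightarrow>
      (\<forall>F\<in>ksets n k. \<not> F \<subseteq> A \<longrightarrow> (\<forall>i\<in>A. lookup (p F) i = 0))" .
qed

text \<open>Sizes strictly between 1 and \<open>k\<close> are left out: there the bound is zero, so
  at a point of the polytope such a set is tight exactly if all its singletons are.\<close>

definition tight_sets :: "nat \<Rightarrow> nat \<Rightarrow> (nat \<Rightarrow>\<^sub>0 real) \<Rightarrow> nat set set" where
  "tight_sets n k x = {A. A \<subseteq> {1..n} \<and> (card A = 1 \<or> k \<le> card A) \<and> mass x A = num_ksets n k A}"

lemma tight_sets_iff:
  assumes "decomposes n k p x"
  shows "A \<in> tight_sets n k x \<longleftrightarrow> A \<subseteq> {1..n} \<and> (card A = 1 \<or> k \<le> card A) \<and>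
    (\<forall>F\<in>ksets n k. \<not> F \<subseteq> A \<longrightarrow> (\<forall>i\<in>A. lookup (p F) i = 0))"
  using mass_ge_num_ksets(2)[OF assms, of A] finite_subset[of A "{1..n}"]
  by (auto simp: tight_sets_def)

lemma decomposes_support:
  assumes "decomposes n k p x" "F \<in> ksets n k"
  obtains i where "i \<in> F" "0 < lookup (p F) i"
proof -
  have "\<exists>i\<in>F. lookup (p F) i \<noteq> 0"
  proof (rule ccontr)
    assume "\<not> ?thesis"
    then have "mass (p F) F = 0" by (simp add: mass_def)
    then show False using decomposesD(3)[OF assms] by simp
  qed
  then show ?thesis using that decomposesD(1)[OF assms] by (metis order_le_less)
qed

text \<open>A violation leaves some \<open>F\<close> nowhere to put its mass. For incomparable tight
  sets it is an \<open>F \<subseteq> A \<union> B\<close> containing a point of each difference,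
  hence inside neither set; for \<open>k\<close> tight singletons it is the set of their
  points.\<close>

lemma nested_family_tight_sets:
  assumes "x \<in> Pi_polytope n k" "2 \<le> k" "k \<le> n"
  shows "nested_family k {1..n} (tight_sets n k x)"
proof -
  obtain p where p: "decomposes n k p x" using assms(1) Pi_polytope_iff by blast
  note T = tight_sets_iff[OF p]
  have "{1..n} \<in> tight_sets n k x" using assms unfolding T by (auto simp: ksets_def)
  moreover have "A \<subseteq> B \<or> B \<subseteq> A"
    if A: "A \<in> tight_sets n k x" and B: "B \<in> tight_sets n k x" and c: "k \<le> card (A \<union> B)" for A B
  proof (rule ccontr)
    assume "\<not> ?thesis"
    then obtain a b where ab: "a \<in> A" "a \<notin> B" "b \<in> B" "b \<notin> A" by blast
    have AB: "A \<union> B \<subseteq> {1..n}" using A B T by blast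
    then obtain F where F: "F \<subseteq> A \<union> B" "card F = k" "a \<in> F" "b \<in> F"
      using obtain_subset_containing[of "A \<union> B" k a b] ab c assms(2) finite_subset by blast
    then have Fk: "F \<in> ksets n k" using AB by (auto simp: ksets_def)
    obtain i where "i \<in> F" "0 < lookup (p F) i" using decomposes_support[OF p Fk] .
    moreover have "\<not> F \<subseteq> A" "\<not> F \<subseteq> B" using F ab by auto
    ultimately show False using A B Fk F(1) unfolding T by fastforce
  qed
  moreover have "card {i. {i} \<in> tight_sets n k x} < k"
  proof (rule ccontr)
    define R where "R = {i. {i} \<in> tight_sets n k x}"
    assume "\<not> ?thesis"
    then obtain F where F: "F \<subseteq> R" "card F = k" "finite F"
      unfolding R_def not_less by (meson obtain_subset_with_card_n)
    then have Fk: "F \<in> ksets n k" using T by (auto simp: ksets_def R_def)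
    obtain i where i: "i \<in> F" "0 < lookup (p F) i" using decomposes_support[OF p Fk] .
    have "\<not> F \<subseteq> {i}" using F assms(2) card_mono[of "{i}" F] by auto
    then show False using i F(1) Fk unfolding R_def T by fastforce
  qed
  ultimately show ?thesis using assms unfolding nested_family_def by (auto simp: T)
qed

text \<open>Spreading the mass of every \<open>F\<close> evenly over the part of \<open>F\<close> outside all members of
  \<open>\<A>\<close> that do not contain \<open>F\<close> makes exactly the members of \<open>\<A>\<close> tight.\<close>

lemma nested_family_realized:
  assumes nf: "nested_family k {1..n} \<A>"
  obtains x where "x \<in> Pi_polytope n k" "tight_sets n k x = \<A>"
proof -
  note D = nested_familyD[OF nf]
  define G where "G F = F - \<Union>{A \<in> \<A>. \<not> F \<subseteq> A}" for F
  define p where "p F = (\<Sum>i\<in>G F. Poly_Mapping.single i (1 / real (card (G F))))" for F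
  define x where "x = (\<Sum>F\<in>ksets n k. p F)"
  have finG: "finite (G F)" if "F \<in> ksets n k" for F
    using ksetsD(3)[OF that] by (simp add: G_def)
  \<comment> \<open>If members not containing \<open>F\<close> covered \<open>F\<close>, one of them
    would contain it.\<close>
  have Gne: "G F \<noteq> {}" if "F \<in> ksets n k" for F
    using nested_family_union_cover[OF nf, of F F] ksetsD(2)[OF that] unfolding G_def by blast
  have lp: "lookup (p F) i = (if i \<in> G F then 1 / real (card (G F)) else 0)"
    if "F \<in> ksets n k" for F i
    using finG[OF that] by (simp add: p_def Poly_Mapping.lookup_sum lookup_single when_def)
  have pos: "0 < card (G F)" if "F \<in> ksets n k" for F
    using finG[OF that] Gne[OF that] by (simp add: card_gt_0_iff)
  have mp: "mass (p F) F = 1" if "F \<in> ksets n k" for F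
  proof -
    have "mass (p F) F = (\<Sum>i\<in>F \<inter> G F. 1 / real (card (G F)))"
      unfolding mass_def using ksetsD(3)[OF that] lp[OF that] by (simp add: sum.If_cases)
    also have "F \<inter> G F = G F" by (auto simp: G_def)
    finally show ?thesis using pos[OF that] by simp
  qed
  have "p F \<in> simplex_face n F" if "F \<in> ksets n k" for F
    unfolding simplex_face_iff[OF ksetsD(1)[OF that]]
    using mp[OF that] by (auto simp: lp[OF that] G_def)
  then have dec: "decomposes n k p x" by (simp add: decomposes_def x_def)
  have T: "A \<in> tight_sets n k x \<longleftrightarrow> A \<subseteq> {1..n} \<and> (card A = 1 \<or> k \<le> card A) \<and>
    (\<forall>F\<in>ksets n k. \<not> F \<subseteq> A \<longrightarrow> A \<inter> G F = {})" for A
  proof -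
    have "(\<forall>i\<in>A. lookup (p F) i = 0) \<longleftrightarrow> A \<inter> G F = {}" if "F \<in> ksets n k" for F
      using pos[OF that] by (auto simp: lp[OF that])
    then show ?thesis unfolding tight_sets_iff[OF dec] by blast
  qed
  have "\<A> \<subseteq> tight_sets n k x"
  proof
    fix A assume A: "A \<in> \<A>"
    then show "A \<in> tight_sets n k x" using D(6,8)[OF A] unfolding T G_def by blast
  qed
  moreover have "B \<in> \<A>" if B: "B \<in> tight_sets n k x" for B
  proof (rule ccontr)
    assume nB: "B \<notin> \<A>"
    have B': "B \<subseteq> {1..n}" "card B = 1 \<or> k \<le> card B"
      "\<And>F. F \<in> ksets n k \<Longrightarrow> \<not> F \<subseteq> B \<Longrightarrow> B \<inter> G F = {}" using B unfolding T by blast+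
    have fB: "finite B" using B'(1) finite_subset by blast
    \<comment> \<open>For a tight \<open>B\<close> outside \<open>\<A>\<close>, take the smallest
      large member \<open>C\<close> containing \<open>B\<close> and find in it an \<open>F\<close>
      that is not inside \<open>B\<close> but puts mass on some \<open>a \<in> B\<close>, against
      tightness.\<close>
    define \<F> where "\<F> = {A \<in> \<A>. k \<le> card A \<and> B \<subseteq> A}"
    have "{1..n} \<in> \<F>" using D(3,4) B'(1) by (simp add: \<F>_def)
    moreover have "finite \<F>" using D(10) by (simp add: \<F>_def)
    ultimately have "finite \<F>" "\<F> \<noteq> {}" by auto
    then obtain C where C: "C \<in> \<F>" "\<And>A. A \<in> \<F> \<Longrightarrow> C \<subseteq> A"
      by (rule finite_chain_has_min) (auto simp: \<F>_def dest: nested_family_comparable[OF nf])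
    have C': "C \<in> \<A>" "k \<le> card C" "B \<subseteq> C" using C(1) by (auto simp: \<F>_def)
    then have "C \<noteq> B" using nB by blast
    then obtain b where b: "b \<in> C" "b \<notin> B" using C'(3) by blast
    \<comment> \<open>A cover would give one member containing \<open>B\<close> but not
      \<open>C\<close>; minimality of \<open>C\<close> makes it a singleton, hence equal to
      \<open>B\<close>, which is not a member.\<close>
    have "\<not> B \<subseteq> \<Union>{A \<in> \<A>. \<not> C \<subseteq> A}"
    proof
      assume "B \<subseteq> \<Union>{A \<in> \<A>. \<not> C \<subseteq> A}"
      then obtain A where A: "A \<in> \<A>" "\<not> C \<subseteq> A" "B \<subseteq> A"
        using nested_family_union_cover[OF nf B'(2)] by blast
      then have "\<not> k \<le> card A" using C(2) by (auto simp: \<F>_def)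
      then have c: "card A = 1" using D(8)[OF A(1)] by blast
      then have "card B = 1" using card_mono[OF D(7)[OF A(1)] A(3)] B'(2) D(2) by linarith
      then have "B = A" using A(3) c D(7)[OF A(1)] by (intro card_subset_eq) auto
      then show False using A(1) nB by blast
    qed
    then obtain a where a: "a \<in> B" "a \<notin> \<Union>{A \<in> \<A>. \<not> C \<subseteq> A}" by blast
    obtain F where F: "F \<subseteq> C" "card F = k" "a \<in> F" "b \<in> F"
      using obtain_subset_containing[OF D(7)[OF C'(1)] D(2) C'(2), of a b] a b C' by blast
    have "F \<in> ksets n k" using F D(6)[OF C'(1)] by (auto simp: ksets_def)
    moreover have "\<not> F \<subseteq> B" using F b by blast
    moreover have "a \<in> G F" using a F unfolding G_def by blast
    ultimately show False using B'(3) a by blast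
  qed
  ultimately have "tight_sets n k x = \<A>" by blast
  then show ?thesis using that dec Pi_polytope_iff by blast
qed

section \<open>Faces\<close>

lemma convex_Pi_polytope: "convex (Pi_polytope n k)"
proof (rule convexI)
  fix x y :: "nat \<Rightarrow>\<^sub>0 real" and u v :: real
  assume xy: "x \<in> Pi_polytope n k" "y \<in> Pi_polytope n k" and uv: "0 \<le> u" "0 \<le> v" "u + v = 1"
  obtain p q where p: "decomposes n k p x" and q: "decomposes n k q y"
    using xy Pi_polytope_iff by blast
  have "u *\<^sub>R p F + v *\<^sub>R q F \<in> simplex_face n F" if "F \<in> ksets n k" for F
    unfolding simplex_face_iff[OF ksetsD(1)[OF that]]
    using decomposesD[OF p that] decomposesD[OF q that] uv
    by (auto simp: lookup_add mass_add mass_scaleR)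
  then have "decomposes n k (\<lambda>F. u *\<^sub>R p F + v *\<^sub>R q F) (u *\<^sub>R x + v *\<^sub>R y)"
    using p q by (simp add: decomposes_def sum.distrib scaleR_sum_right)
  then show "u *\<^sub>R x + v *\<^sub>R y \<in> Pi_polytope n k" using Pi_polytope_iff by blast
qed

section \<open>Cones of feasible directions\<close>

definition feasible_directions :: "'a::real_vector set \<Rightarrow> 'a \<Rightarrow> 'a set" where
  "feasible_directions P x = {v. \<exists>e>0. x + e *\<^sub>R v \<in> P}"

lemma feasible_directions_add:
  assumes "convex P" "v \<in> feasible_directions P x" "w \<in> feasible_directions P x"
  shows "v + w \<in> feasible_directions P x"
proof -
  obtain d e where d: "0 < d" "x + d *\<^sub>R v \<in> P" and e: "0 < e" "x + e *\<^sub>R w \<in> P"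
    using assms(2,3) by (auto simp: feasible_directions_def)
  have s: "e / (d + e) + d / (d + e) = 1" using d e by (simp flip: add_divide_distrib)
  \<comment> \<open>The weights are swapped so that \<open>v\<close> and \<open>w\<close> both
    receive the coefficient \<open>d * e / (d + e)\<close>.\<close>
  have "(e / (d + e)) *\<^sub>R (x + d *\<^sub>R v) + (d / (d + e)) *\<^sub>R (x + e *\<^sub>R w) \<in> P"
    using assms(1) d e s by (intro convexD) auto
  also have "(e / (d + e)) *\<^sub>R (x + d *\<^sub>R v) + (d / (d + e)) *\<^sub>R (x + e *\<^sub>R w)
      = (e / (d + e) + d / (d + e)) *\<^sub>R x + (d * e / (d + e)) *\<^sub>R (v + w)"
    by (simp add: algebra_simps)
  finally show ?thesis
    using s d e by (auto simp: feasible_directions_def intro!: exI[of _ "d * e / (d + e)"])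
qed

lemma zero_feasible_direction: "x \<in> P \<Longrightarrow> 0 \<in> feasible_directions P x"
  by (auto simp: feasible_directions_def intro: exI[of _ 1])

lemma feasible_directions_scaleR:
  assumes "x \<in> P" "v \<in> feasible_directions P x" "0 \<le> c"
  shows "c *\<^sub>R v \<in> feasible_directions P x"
proof (cases "c = 0")
  case True
  then show ?thesis using zero_feasible_direction[OF assms(1)] by simp
next
  case False
  obtain e where "0 < e" "x + e *\<^sub>R v \<in> P" using assms(2) by (auto simp: feasible_directions_def)
  then show ?thesis using False assms(3)
    by (auto simp: feasible_directions_def intro!: exI[of _ "e / c"])
qed

lemma feasible_directions_sum:
  assumes "convex P" "x \<in> P" "\<And>j. j \<in> J \<Longrightarrow> f j \<in> feasible_directions P x"
  shows "(\<Sum>j\<in>J. f j) \<in> feasible_directions P x"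
  using assms(3)
proof (induction J rule: infinite_finite_induct)
qed (auto intro!: feasible_directions_add zero_feasible_direction assms(1,2))

text \<open>Moving the whole mass of \<open>F\<close> at \<open>i\<close> over to \<open>l\<close>
  keeps the share of \<open>F\<close> in its simplex and leaves the other shares alone.\<close>

lemma exchange_feasible:
  assumes p: "decomposes n k p x" and F: "F \<in> ksets n k" and "i \<in> F" "l \<in> F" "lookup (p F) i \<noteq> 0"
  shows "unit_vec l - unit_vec i \<in> feasible_directions (Pi_polytope n k) x"
proof -
  note d = decomposesD[OF p F]
  define e where "e = lookup (p F) i"
  define w where "w = e *\<^sub>R (unit_vec l - unit_vec i)"
  have e: "0 < e" using d(1)[of i] assms(5) by (simp add: e_def)
  have ind: "mass (unit_vec j) F = 1" if "j \<in> F" for j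
    using that ksetsD(3)[OF F] by (simp add: mass_def lookup_single when_def)
  have "p F + w \<in> simplex_face n F"
    unfolding simplex_face_iff[OF ksetsD(1)[OF F]]
  proof (intro conjI allI impI)
    show "0 \<le> lookup (p F + w) j" for j
      using d(1)[of j] e unfolding w_def e_def
      by (auto simp: lookup_add lookup_minus lookup_single when_def)
    show "lookup (p F + w) j = 0" if "j \<notin> F" for j
      using that assms(3,4) d(2)[OF that] unfolding w_def
      by (auto simp: lookup_add lookup_minus lookup_single when_def)
    show "mass (p F + w) F = 1"
      using d(3) ind assms(3,4) by (simp add: w_def mass_add mass_diff mass_scaleR)
  qed
  then have "decomposes n k (p(F := p F + w)) (x + w)"
    using p F unfolding decomposes_def
    by (auto simp: sum.remove[OF finite_ksets F] algebra_simps intro!: sum.cong)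
  then have "x + w \<in> Pi_polytope n k" using Pi_polytope_iff by blast
  then show ?thesis using e by (auto simp: feasible_directions_def w_def)
qed

text \<open>The set of coordinates to which mass can be moved from \<open>i\<close> by a sequence of exchanges
  inside the summands is itself tight, hence contains \<open>least_member\<close> of the tight family.\<close>

lemma block_exchange_feasible:
  assumes k: "2 \<le> k" "k \<le> n" and x: "x \<in> Pi_polytope n k" and i: "i \<in> {1..n}"
    and ni: "{i} \<notin> tight_sets n k x" and l: "l \<in> least_member (tight_sets n k x) i"
  shows "unit_vec l - unit_vec i \<in> feasible_directions (Pi_polytope n k) x"
proof -
  obtain p where p: "decomposes n k p x" using x Pi_polytope_iff by blast
  \<comment> \<open>An edge \<open>(a, b)\<close> stands for one exchange: some \<open>F\<close> has
    mass at \<open>a\<close> and may move it to \<open>b\<close>. \<open>U\<close> collects what is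
    reachable from \<open>i\<close>.\<close>
  define E where "E = {(a, b). \<exists>F\<in>ksets n k. a \<in> F \<and> b \<in> F \<and> lookup (p F) a \<noteq> 0}"
  define U where "U = {b. (i, b) \<in> E\<^sup>*}"
  have FU: "F \<subseteq> U" if "F \<in> ksets n k" "a \<in> U" "lookup (p F) a \<noteq> 0" for F a
  proof
    fix b assume "b \<in> F"
    moreover have "a \<in> F" using decomposesD(2)[OF p that(1)] that(3) by blast
    ultimately have "(a, b) \<in> E" using that by (auto simp: E_def)
    then show "b \<in> U" using that(2) unfolding U_def by (simp add: rtrancl.rtrancl_into_rtrancl)
  qed
  have feas: "unit_vec b - unit_vec i \<in> feasible_directions (Pi_polytope n k) x"
    and rng: "b \<in> {1..n}" if "b \<in> U" for b
  proof -
    have "(i, b) \<in> E\<^sup>*" using that by (simp add: U_def)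
    then have "unit_vec b - unit_vec i \<in> feasible_directions (Pi_polytope n k) x \<and> b \<in> {1..n}"
    proof (induction rule: rtrancl_induct)
      case base
      then show ?case using zero_feasible_direction[OF x] i by simp
    next
      case (step a b)
      then obtain F where F: "F \<in> ksets n k" "a \<in> F" "b \<in> F" "lookup (p F) a \<noteq> 0"
        by (auto simp: E_def)
      have "(unit_vec a - unit_vec i) + (unit_vec b - unit_vec a)
          \<in> feasible_directions (Pi_polytope n k) x"
        using step.IH exchange_feasible[OF p F(1,2,3,4)]
        by (intro feasible_directions_add convex_Pi_polytope) auto
      moreover have "b \<in> {1..n}" using F(3) ksetsD(1)[OF F(1)] by blast
      ultimately show ?case by simp
    qed
    then show "unit_vec b - unit_vec i \<in> feasible_directions (Pi_polytope n k) x" "b \<in> {1..n}"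
      by blast+
  qed
  have iU: "i \<in> U" by (simp add: U_def)
  \<comment> \<open>Since \<open>{i}\<close> is not tight, some \<open>F\<close> has mass at
    \<open>i\<close>; that \<open>F\<close> lies in \<open>U\<close>, which gives \<open>U\<close>
    the size at least \<open>k\<close> required of a tight set.\<close>
  obtain F where F: "F \<in> ksets n k" "lookup (p F) i \<noteq> 0"
    using ni i unfolding tight_sets_iff[OF p] by auto
  have "F \<subseteq> U" using FU[OF F(1) iU F(2)] .
  moreover have "finite U" using rng finite_subset[of U "{1..n}"] by blast
  ultimately have "k \<le> card U" using card_mono ksetsD(2)[OF F(1)] by metis
  then have "U \<in> tight_sets n k x" using rng FU unfolding tight_sets_iff[OF p] by blast
  then have "least_member (tight_sets n k x) i \<subseteq> U"
    using iU by (auto simp: least_member_def)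
  then show ?thesis using feas l by blast
qed

text \<open>If \<open>{j}\<close> is tight, the block of \<open>j\<close> is \<open>{j}\<close> and
  the difference is zero; otherwise the exchange argument applies. The hypotheses are symmetric in
  \<open>i\<close> and \<open>j\<close>, so both signs are feasible.\<close>

lemma block_difference_feasible:
  assumes k: "2 \<le> k" "k \<le> n" and x: "x \<in> Pi_polytope n k" and ij: "i \<in> {1..n}" "j \<in> {1..n}"
    and eq: "least_member (tight_sets n k x) i = least_member (tight_sets n k x) j"
  shows "unit_vec i - unit_vec j \<in> feasible_directions (Pi_polytope n k) x"
proof (cases "{j} \<in> tight_sets n k x")
  case True
  note nf = nested_family_tight_sets[OF x k]
  have "least_member (tight_sets n k x) j \<subseteq> {j}"
    using True by (auto simp: least_member_def)
  then have "i = j" using least_member(2)[OF nf ij(1)] eq by auto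
  then show ?thesis using zero_feasible_direction[OF x] by simp
next
  case False
  note nf = nested_family_tight_sets[OF x k]
  show ?thesis using block_exchange_feasible[OF k x ij(2) False] least_member(2)[OF nf ij(1)] eq by simp
qed

text \<open>The vectors at the points chosen by \<open>b\<close> enter with the block sums of
  \<open>v\<close> as coefficients, and these vanish, so subtracting them changes nothing.\<close>

lemma block_expansion:
  fixes v :: "nat \<Rightarrow>\<^sub>0 real"
  assumes nf: "nested_family k {1..n} \<A>"
    and supp: "\<And>i. i \<notin> {1..n} \<Longrightarrow> lookup v i = 0"
    and v: "\<And>A. A \<in> \<A> \<Longrightarrow> mass v A = 0"
  shows "v = (\<Sum>i=1..n. lookup v i *\<^sub>R (unit_vec i - unit_vec (b (least_member \<A> i))))"
proof -
  have a: "v = (\<Sum>i=1..n. lookup v i *\<^sub>R unit_vec i)"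
    using supp by (intro poly_mapping_eqI)
      (auto simp: Poly_Mapping.lookup_sum lookup_single when_def if_distrib cong: if_cong)
  have "(\<Sum>i=1..n. lookup v i *\<^sub>R unit_vec (b (least_member \<A> i)))
      = (\<Sum>A\<in>\<A>. \<Sum>i\<in>{i \<in> {1..n}. least_member \<A> i = A}. lookup v i *\<^sub>R unit_vec (b (least_member \<A> i)))"
    using nested_familyD(10)[OF nf] least_member(1)[OF nf]
    by (intro sum.group[symmetric]) auto
  also have "\<dots> = (\<Sum>A\<in>\<A>. (\<Sum>i\<in>{i \<in> {1..n}. least_member \<A> i = A}. lookup v i) *\<^sub>R unit_vec (b A))"
    by (intro sum.cong refl) (simp add: scaleR_sum_left)
  also have "\<dots> = 0"
    using nested_family_block_sum_zero[OF nf, of "lookup v"] v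
    by (intro sum.neutral) (simp add: mass_def)
  finally show ?thesis using a by (simp add: scaleR_diff_right sum_subtractf)
qed

lemma Pi_polytope_support:
  assumes "x \<in> Pi_polytope n k" "i \<notin> {1..n}"
  shows "lookup x i = 0"
proof -
  obtain p where p: "decomposes n k p x" using assms(1) Pi_polytope_iff by blast
  have "lookup (p F) i = 0" if "F \<in> ksets n k" for F
    using decomposesD(2)[OF p that] ksetsD(1)[OF that] assms(2) by blast
  then show ?thesis using p by (simp add: decomposes_def Poly_Mapping.lookup_sum)
qed

text \<open>The expansion over blocks uses differences that are feasible with either sign, so the
  signs of the coefficients do not matter. Consequently \<open>x\<close> is a relative interior
  point of the face cut out by its tight sets.\<close>

lemma feasible_of_mass_zero:
  assumes k: "2 \<le> k" "k \<le> n" and x: "x \<in> Pi_polytope n k"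
    and supp: "\<And>i. i \<notin> {1..n} \<Longrightarrow> lookup v i = 0"
    and v: "\<And>A. A \<in> tight_sets n k x \<Longrightarrow> mass v A = 0"
  shows "v \<in> feasible_directions (Pi_polytope n k) x"
proof -
  note nf = nested_family_tight_sets[OF x k]
  let ?c = "least_member (tight_sets n k x)"
  obtain b where b: "\<And>A. A \<in> tight_sets n k x \<Longrightarrow> b A \<in> {1..n} \<and> b A \<in> A \<and> ?c (b A) = A"
    using obtain_block_representatives[OF nf] by metis
  have "lookup v i *\<^sub>R (unit_vec i - unit_vec (b (?c i))) \<in> feasible_directions (Pi_polytope n k) x"
    if i: "i \<in> {1..n}" for i
  proof -
    have j: "b (?c i) \<in> {1..n}" "?c (b (?c i)) = ?c i" using b[OF least_member(1)[OF nf i]] by auto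
    show ?thesis
    proof (cases "0 \<le> lookup v i")
      case True
      then show ?thesis
        by (intro feasible_directions_scaleR x block_difference_feasible k i j) (simp add: j)
    next
      case False
      have "(- lookup v i) *\<^sub>R (unit_vec (b (?c i)) - unit_vec i) \<in> feasible_directions (Pi_polytope n k) x"
        using False
        by (intro feasible_directions_scaleR x block_difference_feasible k i j) (auto simp: j)
      then show ?thesis by (simp add: algebra_simps)
    qed
  qed
  then have "(\<Sum>i=1..n. lookup v i *\<^sub>R (unit_vec i - unit_vec (b (?c i))))
      \<in> feasible_directions (Pi_polytope n k) x"
    by (intro feasible_directions_sum convex_Pi_polytope x) auto
  then show ?thesis using block_expansion[OF nf supp v, of b] by simp
qed

section \<open>Faces cut out by nested families\<close>

definition face_of_family :: "nat \<Rightarrow> nat \<Rightarrow> nat set set \<Rightarrow> (nat \<Rightarrow>\<^sub>0 real) set" where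
  "face_of_family n k \<A> = {x \<in> Pi_polytope n k. \<A> \<subseteq> tight_sets n k x}"

text \<open>Both masses are at least the bound, so a mixture with positive weights attains it only
  if both do.\<close>

lemma tight_sets_convex_combination:
  assumes x: "x \<in> Pi_polytope n k" and y: "y \<in> Pi_polytope n k" and u: "0 < u" "u < 1"
  shows "tight_sets n k ((1 - u) *\<^sub>R x + u *\<^sub>R y) = tight_sets n k x \<inter> tight_sets n k y"
proof -
  have ge: "num_ksets n k A \<le> mass z A" if "z \<in> Pi_polytope n k" "A \<subseteq> {1..n}" for z A
    using that Pi_polytope_iff mass_ge_num_ksets(1) finite_subset[of A "{1..n}"] by blast
  have "(1 - u) * a + u * b = c \<longleftrightarrow> a = c \<and> b = c" if "c \<le> a" "c \<le> b" for a b c :: real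
  proof -
    have "(1 - u) * a + u * b = c \<longleftrightarrow> (1 - u) * (a - c) + u * (b - c) = 0"
      by (simp add: algebra_simps)
    also have "\<dots> \<longleftrightarrow> (1 - u) * (a - c) = 0 \<and> u * (b - c) = 0"
      using that u by (intro add_nonneg_eq_0_iff) auto
    finally show ?thesis using u by simp
  qed
  then have "mass ((1 - u) *\<^sub>R x + u *\<^sub>R y) A = num_ksets n k A \<longleftrightarrow>
      mass x A = num_ksets n k A \<and> mass y A = num_ksets n k A" if "A \<subseteq> {1..n}" for A
    unfolding mass_add mass_scaleR using ge[OF x that] ge[OF y that] by blast
  then show ?thesis unfolding tight_sets_def by blast
qed

lemma face_of_family_face_of: "face_of_family n k \<A> face_of Pi_polytope n k"
  unfolding face_of_def
proof (intro conjI ballI impI)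
  show "face_of_family n k \<A> \<subseteq> Pi_polytope n k" by (auto simp: face_of_family_def)
  show "convex (face_of_family n k \<A>)"
    unfolding convex_alt
  proof (intro ballI allI impI)
    fix x y and u :: real
    assume *: "x \<in> face_of_family n k \<A>" "y \<in> face_of_family n k \<A>" "0 \<le> u \<and> u \<le> 1"
    then have "(1 - u) *\<^sub>R x + u *\<^sub>R y \<in> Pi_polytope n k"
      using convex_Pi_polytope[of n k] unfolding convex_alt face_of_family_def by blast
    moreover have "\<A> \<subseteq> tight_sets n k ((1 - u) *\<^sub>R x + u *\<^sub>R y)"
      using * tight_sets_convex_combination[of x n k y u]
      by (cases "u = 0 \<or> u = 1") (auto simp: face_of_family_def)
    ultimately show "(1 - u) *\<^sub>R x + u *\<^sub>R y \<in> face_of_family n k \<A>"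
      by (simp add: face_of_family_def)
  qed
  fix a b x assume *: "a \<in> Pi_polytope n k" "b \<in> Pi_polytope n k" "x \<in> face_of_family n k \<A>"
    "x \<in> open_segment a b"
  then obtain u where "0 < u" "u < 1" "x = (1 - u) *\<^sub>R a + u *\<^sub>R b"
    by (auto simp: in_segment)
  then have "\<A> \<subseteq> tight_sets n k a \<inter> tight_sets n k b"
    using * tight_sets_convex_combination by (auto simp: face_of_family_def)
  then show "a \<in> face_of_family n k \<A>" "b \<in> face_of_family n k \<A>"
    using * by (auto simp: face_of_family_def)
qed

lemma face_of_Pi_polytope_obtain_family:
  assumes k: "2 \<le> k" "k \<le> n" and T: "T face_of Pi_polytope n k" "T \<noteq> {}"
  obtains \<A> where "nested_family k {1..n} \<A>" "T = face_of_family n k \<A>"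
proof -
  have TP: "T \<subseteq> Pi_polytope n k" and cT: "convex T" using T by (auto simp: face_of_def)
  \<comment> \<open>A point with the fewest tight sets acts as a relative interior point of
    \<open>T\<close>: the midpoint with any \<open>y \<in> T\<close> has only the common tight sets,
    so minimality forces those of \<open>x\<close> to be tight at \<open>y\<close>.\<close>
  obtain x where x: "x \<in> T" and min: "\<And>y. y \<in> T \<Longrightarrow> card (tight_sets n k x) \<le> card (tight_sets n k y)"
    using T(2) ex_has_least_nat[of "\<lambda>x. x \<in> T" _ "\<lambda>x. card (tight_sets n k x)"] by blast
  have xP: "x \<in> Pi_polytope n k" using x TP by blast
  note nf = nested_family_tight_sets[OF xP k]
  have sub: "tight_sets n k x \<subseteq> tight_sets n k y" if y: "y \<in> T" for y
  proof -
    let ?m = "(1 - 1/2) *\<^sub>R x + (1/2 :: real) *\<^sub>R y"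
    have "?m \<in> T" using cT x y by (intro convexD) auto
    then have "card (tight_sets n k x) \<le> card (tight_sets n k x \<inter> tight_sets n k y)"
      using min tight_sets_convex_combination[OF xP subsetD[OF TP y], of "1/2"]
      by fastforce
    then have "tight_sets n k x \<inter> tight_sets n k y = tight_sets n k x"
      using nested_familyD(10)[OF nf] by (intro card_seteq) auto
    then show ?thesis by blast
  qed
  have "y \<in> T" if y: "y \<in> face_of_family n k (tight_sets n k x)" for y
  proof (cases "y = x")
    case False
    have yP: "y \<in> Pi_polytope n k" and yt: "tight_sets n k x \<subseteq> tight_sets n k y"
      using y by (auto simp: face_of_family_def)
    \<comment> \<open>The direction from \<open>y\<close> to \<open>x\<close> preserves all tight
      masses, so the segment can be prolonged beyond \<open>x\<close> to a point \<open>z\<close>.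
      Then \<open>x\<close> is interior to the segment from \<open>y\<close> to \<open>z\<close>,
      and the face \<open>T\<close> must contain \<open>y\<close>.\<close>
    have "x - y \<in> feasible_directions (Pi_polytope n k) x"
    proof (rule feasible_of_mass_zero[OF k xP])
      show "lookup (x - y) i = 0" if "i \<notin> {1..n}" for i
        using Pi_polytope_support[OF xP that] Pi_polytope_support[OF yP that] by (simp add: lookup_minus)
      show "mass (x - y) A = 0" if "A \<in> tight_sets n k x" for A
        using that yt by (auto simp: mass_diff tight_sets_def)
    qed
    then obtain e where e: "0 < e" "x + e *\<^sub>R (x - y) \<in> Pi_polytope n k"
      by (auto simp: feasible_directions_def)
    define z where "z = x + e *\<^sub>R (x - y)"
    have "x = (1 - 1 / (1 + e)) *\<^sub>R y + (1 / (1 + e)) *\<^sub>R z"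
    proof -
      have "(1 + e) *\<^sub>R ((1 - 1 / (1 + e)) *\<^sub>R y + (1 / (1 + e)) *\<^sub>R z)
          = ((1 + e) * (1 - 1 / (1 + e))) *\<^sub>R y + ((1 + e) * (1 / (1 + e))) *\<^sub>R z"
        by (simp only: scaleR_add_right scaleR_scaleR)
      also have "(1 + e) * (1 - 1 / (1 + e)) = e" using e(1) by (simp add: field_simps)
      also have "(1 + e) * (1 / (1 + e)) = 1" using e(1) by simp
      also have "e *\<^sub>R y + 1 *\<^sub>R z = (1 + e) *\<^sub>R x"
        by (simp add: z_def algebra_simps)
      finally show ?thesis using e(1) by (metis add_pos_pos less_numeral_extra(3) scaleR_left_imp_eq zero_less_one)
    qed
    moreover have "y \<noteq> z"
    proof
      assume "y = z"
      then have "(1 + e) *\<^sub>R (x - y) = 0" by (simp add: z_def algebra_simps)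
      then show False using e(1) False by simp
    qed
    ultimately have "x \<in> open_segment y z"
      using e(1) by (auto simp: in_segment intro!: exI[of _ "1 / (1 + e)"])
    then show ?thesis using T(1) yP e(2) x unfolding face_of_def z_def by blast
  qed (use x in simp)
  then have "T = face_of_family n k (tight_sets n k x)"
    using sub TP by (auto simp: face_of_family_def)
  then show ?thesis using that nf by blast
qed

text \<open>The point realizing \<open>\<A>\<close> has no further tight sets, so it lies in the
  face of \<open>\<B>\<close> only if \<open>\<B> \<subseteq> \<A>\<close>.\<close>

lemma face_of_family_mono_iff:
  assumes "nested_family k {1..n} \<A>"
  shows "face_of_family n k \<A> \<subseteq> face_of_family n k \<B> \<longleftrightarrow> \<B> \<subseteq> \<A>"
  using nested_family_realized[OF assms] unfolding face_of_family_def by blast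

lemma face_of_family_nonempty:
  assumes "nested_family k {1..n} \<A>"
  shows "face_of_family n k \<A> \<noteq> {}"
  using nested_family_realized[OF assms] unfolding face_of_family_def by blast

text \<open>Differences of points of the face have zero mass on every member, hence are spanned by
  differences inside blocks. With one representative per block, \<open>n - card \<A>\<close> such
  differences suffice; they are independent, and all are feasible at the point whose tight sets are
  exactly \<open>\<A>\<close>.\<close>

lemma affine_dim_face_of_family:
  assumes nf: "nested_family k {1..n} \<A>"
  shows "card \<A> \<le> n" "affine_dim (face_of_family n k \<A>) = int (n - card \<A>)"
proof -
  note D = nested_familyD[OF nf]
  have k: "2 \<le> k" "k \<le> n" using D by auto
  obtain x where x: "x \<in> Pi_polytope n k" and tx: "tight_sets n k x = \<A>"
    using nested_family_realized[OF nf] .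
  obtain b where b: "\<And>A. A \<in> \<A> \<Longrightarrow> b A \<in> {1..n} \<and> b A \<in> A \<and> least_member \<A> (b A) = A"
    and injb: "inj_on b \<A>"
    using obtain_block_representatives[OF nf] by metis
  have cb: "card (b ` \<A>) = card \<A>" using injb by (rule card_image)
  have bsub: "b ` \<A> \<subseteq> {1..n}" using b by blast
  show "card \<A> \<le> n" using card_mono[OF _ bsub] cb by simp
  define J where "J = {1..n} - b ` \<A>"
  define w where "w i = unit_vec i - unit_vec (b (least_member \<A> i))" for i
  have cJ: "card J = n - card \<A>" unfolding J_def using bsub cb by (simp add: card_Diff_subset finite_subset)
  \<comment> \<open>Among the \<open>w j\<close> with \<open>j \<in> J\<close>, only
    \<open>w i\<close> involves the coordinate \<open>i\<close>, because representatives lie outside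
    \<open>J\<close>.\<close>
  have lw: "lookup (w j) i = (if i = j then 1 else 0)" if "i \<in> J" "j \<in> J" for i j
  proof -
    have "b (least_member \<A> j) \<noteq> i" using that least_member(1)[OF nf, of j] by (auto simp: J_def)
    then show ?thesis by (auto simp: w_def lookup_minus lookup_single when_def)
  qed
  have injw: "inj_on w J"
  proof (rule inj_onI)
    fix i j assume "i \<in> J" "j \<in> J" "w i = w j"
    then show "i = j" using lw[of i i] lw[of i j] by (metis zero_neq_one)
  qed
  have finJ: "finite J" by (simp add: J_def)
  have ind: "independent (w ` J)"
  proof (rule independent_if_scalars_zero)
    fix f v assume s: "(\<Sum>v\<in>w ` J. f v *\<^sub>R v) = 0" and v: "v \<in> w ` J"
    then obtain i where i: "i \<in> J" "v = w i" by blast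
    have "0 = lookup (\<Sum>v\<in>w ` J. f v *\<^sub>R v) i" using s by simp
    also have "\<dots> = (\<Sum>j\<in>J. f (w j) * lookup (w j) i)"
      by (simp add: sum.reindex[OF injw] Poly_Mapping.lookup_sum)
    also have "\<dots> = (\<Sum>j\<in>J. if j = i then f (w j) else 0)"
      by (intro sum.cong refl) (use lw[OF i(1)] in auto)
    also have "\<dots> = f v" using i finJ by simp
    finally show "f v = 0" by simp
  qed (simp add: finJ)
  let ?d = "{a - c |a c. a \<in> face_of_family n k \<A> \<and> c \<in> face_of_family n k \<A>}"
  have "w i \<in> span ?d" if "i \<in> J" for i
  proof -
    have i: "i \<in> {1..n}" using that by (auto simp: J_def)
    have j: "b (least_member \<A> i) \<in> {1..n}" "least_member \<A> (b (least_member \<A> i)) = least_member \<A> i"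
      using b[OF least_member(1)[OF nf i]] by auto
    have "w i \<in> feasible_directions (Pi_polytope n k) x"
      unfolding w_def by (rule block_difference_feasible[OF k x i j(1)]) (simp add: tx j)
    then obtain e where e: "0 < e" "x + e *\<^sub>R w i \<in> Pi_polytope n k"
      by (auto simp: feasible_directions_def)
    have mw: "mass (w i) A = 0" if A: "A \<in> \<A>" for A
    proof -
      have "i \<in> A \<longleftrightarrow> b (least_member \<A> i) \<in> A"
        using least_member(3)[OF nf i A] least_member(3)[OF nf j(1) A] j(2) by simp
      then show ?thesis using D(7)[OF A]
        by (simp add: w_def mass_def lookup_minus lookup_single when_def sum_subtractf)
    qed
    have "\<A> \<subseteq> tight_sets n k (x + e *\<^sub>R w i)"
      using tx mw unfolding tight_sets_def by (auto simp: mass_add mass_scaleR)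
    then have "x + e *\<^sub>R w i \<in> face_of_family n k \<A>" "x \<in> face_of_family n k \<A>"
      using e x tx by (auto simp: face_of_family_def)
    then have "(x + e *\<^sub>R w i) - x \<in> ?d" by blast
    then have "(1 / e) *\<^sub>R (e *\<^sub>R w i) \<in> span ?d" by (intro span_scale span_base) simp
    then show ?thesis using e(1) by simp
  qed
  moreover have "v \<in> span (w ` J)" if vd: "v \<in> ?d" for v
  proof -
    obtain y z where v: "v = y - z" and y: "y \<in> face_of_family n k \<A>" and z: "z \<in> face_of_family n k \<A>"
      using vd by blast
    have yz: "y \<in> Pi_polytope n k" "z \<in> Pi_polytope n k" using y z by (auto simp: face_of_family_def)
    have "v = (\<Sum>i=1..n. lookup v i *\<^sub>R w i)" unfolding w_def
    proof (rule block_expansion[OF nf])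
      show "lookup v i = 0" if "i \<notin> {1..n}" for i
        using Pi_polytope_support[OF yz(1) that] Pi_polytope_support[OF yz(2) that] v by (simp add: lookup_minus)
      show "mass v A = 0" if "A \<in> \<A>" for A
      proof -
        have "A \<in> tight_sets n k y" "A \<in> tight_sets n k z"
          using that y z by (auto simp: face_of_family_def)
        then show ?thesis by (simp add: v mass_diff tight_sets_def)
      qed
    qed
    moreover have "w i \<in> span (w ` J)" if i: "i \<in> {1..n}" for i
    proof (cases "i \<in> J")
      case False
      then obtain A where "A \<in> \<A>" "i = b A" using i by (auto simp: J_def)
      then have "w i = 0" using b by (simp add: w_def)
      then show ?thesis by (simp add: span_zero)
    qed (simp add: span_base)
    ultimately show ?thesis by (metis (no_types, lifting) span_sum span_scale)
  qed
  ultimately have "span (w ` J) = span ?d" by (subst span_eq) auto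
  then have "dim ?d = card (w ` J)" using ind by (intro dim_eq_card) auto
  then show "affine_dim (face_of_family n k \<A>) = int (n - card \<A>)"
    using face_of_family_nonempty[OF nf] card_image[OF injw] cJ by (simp add: affine_dim_def)
qed

section \<open>Flags\<close>

text \<open>Deleting \<open>e\<close> gives a sum over all subsets of \<open>A - {e}\<close>: the
  binomial theorem, with one factor \<open>z + c\<close> per remaining element.\<close>

lemma sum_powers_over_subsets_containing:
  fixes z c :: "'b::comm_semiring_1"
  assumes "finite A" "e \<in> A"
  shows "(\<Sum>B | B \<subseteq> A \<and> e \<in> B. z ^ (card A - card B) * c ^ (card B - 1)) = (z + c) ^ (card A - 1)"
proof -
  define A0 where "A0 = A - {e}"
  have A0: "finite A0" "e \<notin> A0" "A = insert e A0" using assms by (auto simp: A0_def)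
  have "(\<Sum>B | B \<subseteq> A \<and> e \<in> B. z ^ (card A - card B) * c ^ (card B - 1))
      = (\<Sum>B\<in>Pow A0. c ^ card B * z ^ card (A0 - B))"
  proof (rule sum.reindex_bij_witness[of _ "insert e" "\<lambda>B. B - {e}"])
    fix B assume "B \<in> {B. B \<subseteq> A \<and> e \<in> B}"
    then have B: "B \<subseteq> A" "e \<in> B" by auto
    have "finite B" using B(1) assms(1) finite_subset by blast
    then have "card B = Suc (card (B - {e}))" using B(2) by (rule card.remove)
    moreover have "card A = Suc (card A0)" using A0 by simp
    moreover have "card (A0 - (B - {e})) = card A0 - card (B - {e})"
      using B A0 \<open>finite B\<close> by (intro card_Diff_subset) auto
    ultimately show "c ^ card (B - {e}) * z ^ card (A0 - (B - {e}))
        = z ^ (card A - card B) * c ^ (card B - 1)" by (simp add: mult.commute)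
  qed (use A0 in auto)
  also have "\<dots> = (\<Prod>i\<in>A0. c + z)"
    unfolding prod_add[OF A0(1)] by simp
  finally show ?thesis using A0 by (simp add: add.commute)
qed

text \<open>\<open>A\<close> is the head of the chain but is not listed. The marked element
  \<open>e\<close> will be the ground set \<open>{1..n}\<close>, which every nested family has to
  contain.\<close>

definition chains_below :: "'a set \<Rightarrow> 'a \<Rightarrow> nat \<Rightarrow> 'a set list set" where
  "chains_below A e l =
     {Bs. length Bs = l \<and> sorted_wrt (\<lambda>A B. B \<subseteq> A) (A # Bs) \<and> (\<forall>B\<in>set Bs. e \<in> B)}"

lemma chains_below_0: "chains_below A e 0 = {[]}"
  by (auto simp: chains_below_def)

lemma bij_betw_chains_below_Suc:
  "bij_betw (\<lambda>(B, Bs). B # Bs) (SIGMA B:{B. B \<subseteq> A \<and> e \<in> B}. chains_below B e l)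
    (chains_below A e (Suc l))"
proof (rule bij_betwI')
  fix Cs assume "Cs \<in> chains_below A e (Suc l)"
  then show "\<exists>x\<in>(SIGMA B:{B. B \<subseteq> A \<and> e \<in> B}. chains_below B e l). Cs = (\<lambda>(B, Bs). B # Bs) x"
    by (cases Cs) (auto simp: chains_below_def)
qed (fastforce simp: chains_below_def)+

lemma finite_chains_below: "finite A \<Longrightarrow> finite (chains_below A e l)"
proof (induction l arbitrary: A)
  case (Suc l)
  have "finite (SIGMA B:{B. B \<subseteq> A \<and> e \<in> B}. chains_below B e l)"
    using Suc finite_subset by (intro finite_SigmaI) auto
  then show ?case by (simp only: bij_betw_finite[OF bij_betw_chains_below_Suc])
qed (simp add: chains_below_0)

text \<open>The tail below the first entry \<open>B\<close> contributes a power with exponent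
  \<open>card B - 1\<close>, and summing over \<open>B\<close> adds \<open>z 0\<close> to the base
  by the binomial theorem. In other words, each element of \<open>A\<close> other than
  \<open>e\<close> chooses the step at which it is dropped, or stays throughout.\<close>

lemma weighted_sum_chains_below:
  fixes z :: "nat \<Rightarrow> 'b::comm_semiring_1"
  assumes "finite A" "e \<in> A"
  shows "(\<Sum>Bs\<in>chains_below A e l. \<Prod>i<l. z i ^ (card ((A # Bs) ! i) - card (Bs ! i)))
    = ((\<Sum>i<l. z i) + 1) ^ (card A - 1)"
  using assms
proof (induction l arbitrary: A z)
  case 0
  then show ?case by (simp add: chains_below_0)
next
  case (Suc l)
  let ?P = "{B. B \<subseteq> A \<and> e \<in> B}"
  have finB: "finite B" if "B \<in> ?P" for B using that Suc.prems finite_subset by blast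
  have "(\<Sum>Bs\<in>chains_below A e (Suc l). \<Prod>i<Suc l. z i ^ (card ((A # Bs) ! i) - card (Bs ! i)))
      = (\<Sum>(B, Bs)\<in>(SIGMA B:?P. chains_below B e l). z 0 ^ (card A - card B) *
          (\<Prod>i<l. z (Suc i) ^ (card ((B # Bs) ! i) - card (Bs ! i))))"
    unfolding sum.reindex_bij_betw[OF bij_betw_chains_below_Suc, symmetric]
    by (intro sum.cong refl) (auto simp: prod.lessThan_Suc_shift simp del: prod.lessThan_Suc)
  also have "\<dots> = (\<Sum>B\<in>?P. \<Sum>Bs\<in>chains_below B e l. z 0 ^ (card A - card B) *
          (\<Prod>i<l. z (Suc i) ^ (card ((B # Bs) ! i) - card (Bs ! i))))"
    using Suc.prems(1) finB by (intro sum.Sigma[symmetric] ballI finite_chains_below) simp_all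
  also have "\<dots> = (\<Sum>B\<in>?P. z 0 ^ (card A - card B) * ((\<Sum>i<l. z (Suc i)) + 1) ^ (card B - 1))"
  proof (intro sum.cong refl)
    fix B assume "B \<in> ?P"
    then show "(\<Sum>Bs\<in>chains_below B e l. z 0 ^ (card A - card B) *
          (\<Prod>i<l. z (Suc i) ^ (card ((B # Bs) ! i) - card (Bs ! i))))
        = z 0 ^ (card A - card B) * ((\<Sum>i<l. z (Suc i)) + 1) ^ (card B - 1)"
      using Suc.IH[of B "\<lambda>i. z (Suc i)"] finB by (simp add: sum_distrib_left[symmetric])
  qed
  also have "\<dots> = (z 0 + ((\<Sum>i<l. z (Suc i)) + 1)) ^ (card A - 1)"
    using sum_powers_over_subsets_containing[OF Suc.prems] .
  finally show ?case by (simp add: sum.lessThan_Suc_shift add.assoc del: sum.lessThan_Suc)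
qed

section \<open>Flags of faces as descending chains of nested families\<close>

definition family_chains :: "nat \<Rightarrow> nat \<Rightarrow> nat \<Rightarrow> nat set set list set" where
  "family_chains n k l = {Cs. length Cs = l \<and> sorted_wrt (\<lambda>A B. B \<subseteq> A) Cs \<and>
     (\<forall>\<A>\<in>set Cs. nested_family k {1..n} \<A>)}"

lemma finite_nested_families: "finite {\<A>. nested_family k X \<A>}"
proof (cases "finite X")
  case True
  have "{\<A>. nested_family k X \<A>} \<subseteq> Pow (Pow X)" by (auto dest: nested_familyD(6))
  then show ?thesis using True finite_subset by blast
qed (simp add: nested_family_def)

lemma finite_family_chains: "finite (family_chains n k l)"
proof (rule finite_subset)
  show "family_chains n k l \<subseteq> {Cs. set Cs \<subseteq> {\<A>. nested_family k {1..n} \<A>} \<and> length Cs = l}"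
    by (auto simp: family_chains_def)
qed (intro finite_lists_length_eq finite_nested_families)

lemma flag_number_Pi_polytope:
  assumes k: "2 \<le> k" "k \<le> n"
  shows "flag_number s (Pi_polytope n k)
    = card {Cs \<in> family_chains n k (length s). map (\<lambda>\<A>. n - card \<A>) Cs = s}"
proof -
  let ?\<Phi> = "face_of_family n k"
  let ?L = "{Cs \<in> family_chains n k (length s). map (\<lambda>\<A>. n - card \<A>) Cs = s}"
  let ?R = "{As. length As = length s \<and> sorted_wrt (\<subseteq>) As \<and>
      (\<forall>i<length s. As ! i face_of Pi_polytope n k \<and> affine_dim (As ! i) = int (s ! i))}"
  have eqiff: "\<A> = \<B>" if "nested_family k {1..n} \<A>" "nested_family k {1..n} \<B>" "?\<Phi> \<A> = ?\<Phi> \<B>" for \<A> \<B>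
    using face_of_family_mono_iff that by (metis order_refl subset_antisym)
  have "bij_betw (map ?\<Phi>) ?L ?R"
    unfolding bij_betw_def
  proof (intro conjI subset_antisym)
    show "inj_on (map ?\<Phi>) ?L"
    proof (rule inj_onI)
      fix Cs Ds assume a: "Cs \<in> ?L" "Ds \<in> ?L" "map ?\<Phi> Cs = map ?\<Phi> Ds"
      have "inj_on ?\<Phi> (set Cs \<union> set Ds)"
        using a(1,2) eqiff by (auto simp: inj_on_def family_chains_def)
      then show "Cs = Ds" using a(3) by (rule map_inj_on[rotated])
    qed
    show "map ?\<Phi> ` ?L \<subseteq> ?R"
    proof
      fix As assume "As \<in> map ?\<Phi> ` ?L"
      then obtain Cs where Cs: "Cs \<in> family_chains n k (length s)" "map (\<lambda>\<A>. n - card \<A>) Cs = s"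
        and As: "As = map ?\<Phi> Cs" by blast
      have len: "length Cs = length s" and srt: "sorted_wrt (\<lambda>A B. B \<subseteq> A) Cs"
        and nf: "\<And>i. i < length s \<Longrightarrow> nested_family k {1..n} (Cs ! i)"
        using Cs(1) by (auto simp: family_chains_def)
      have "sorted_wrt (\<subseteq>) As"
        unfolding As sorted_wrt_map
        using srt by (rule sorted_wrt_mono_rel[rotated]) (auto simp: face_of_family_def)
      moreover have "s ! i = n - card (Cs ! i)" if "i < length s" for i
        using Cs(2) len that by (metis nth_map)
      ultimately show "As \<in> ?R"
        using len nf affine_dim_face_of_family(2) face_of_family_face_of by (auto simp: As)
    qed
    show "?R \<subseteq> map ?\<Phi> ` ?L"
    proof
      fix As assume "As \<in> ?R"
      then have len: "length As = length s" and srt: "sorted_wrt (\<subseteq>) As"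
        and face: "\<And>i. i < length s \<Longrightarrow> As ! i face_of Pi_polytope n k"
        and dims: "\<And>i. i < length s \<Longrightarrow> affine_dim (As ! i) = int (s ! i)" by auto
      have "\<exists>\<A>. nested_family k {1..n} \<A> \<and> As ! i = ?\<Phi> \<A>" if "i < length s" for i
      proof -
        \<comment> \<open>The empty face has \<open>affine_dim\<close> equal to -1, so prescribing
          natural numbers as dimensions excludes it.\<close>
        have "As ! i \<noteq> {}" using dims[OF that] by (auto simp: affine_dim_def)
        then show ?thesis using face_of_Pi_polytope_obtain_family[OF k face[OF that]] by metis
      qed
      then obtain f where f: "\<And>i. i < length s \<Longrightarrow> nested_family k {1..n} (f i) \<and> As ! i = ?\<Phi> (f i)"
        by metis
      define Cs where "Cs = map f [0..<length s]"
      have As: "As = map ?\<Phi> Cs" using f len by (intro nth_equalityI) (auto simp: Cs_def)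
      have "sorted_wrt (\<lambda>A B. B \<subseteq> A) Cs"
        unfolding sorted_wrt_iff_nth_less
      proof (intro allI impI)
        fix i j assume ij: "i < j" "j < length Cs"
        then have "As ! i \<subseteq> As ! j" using srt len by (auto simp: sorted_wrt_iff_nth_less Cs_def)
        then show "Cs ! j \<subseteq> Cs ! i"
          using f[of i] f[of j] ij face_of_family_mono_iff by (auto simp: Cs_def)
      qed
      moreover have "map (\<lambda>\<A>. n - card \<A>) Cs = s"
      proof (rule nth_equalityI)
        fix i assume "i < length (map (\<lambda>\<A>. n - card \<A>) Cs)"
        then have i: "i < length s" by (simp add: Cs_def)
        then show "map (\<lambda>\<A>. n - card \<A>) Cs ! i = s ! i"
          using f[OF i] dims[OF i] affine_dim_face_of_family(2)[of k n "f i"] by (simp add: Cs_def)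
      qed (simp add: Cs_def)
      ultimately have "Cs \<in> ?L" using f by (auto simp: family_chains_def Cs_def)
      then show "As \<in> map ?\<Phi> ` ?L" using As by blast
    qed
  qed
  from bij_betw_same_card[OF this] show ?thesis by (simp add: flag_number_def)
qed

lemma nested_family_singleton:
  assumes "finite X" "2 \<le> k" "k \<le> card X"
  shows "nested_family k X {X}"
proof -
  have "{i. X = {i}} = {}" using assms by auto
  then have "{i. {i} = X} = {}" by blast
  then show ?thesis using assms by (simp add: nested_family_def)
qed

lemma affine_dim_Pi_polytope:
  assumes "2 \<le> k" "k \<le> n"
  shows "affine_dim (Pi_polytope n k) = int (n - 1)"
proof -
  have "face_of_family n k {{1..n}} = Pi_polytope n k"
    using nested_family_tight_sets assms by (auto simp: face_of_family_def dest: nested_familyD(4))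
  then show ?thesis
    using affine_dim_face_of_family(2)[OF nested_family_singleton[of "{1..n}" k]] assms by simp
qed

lemma to_fract_prod: "to_fract (\<Prod>i\<in>I. f i) = (\<Prod>i\<in>I. to_fract (f i))"
  by (induction I rule: infinite_finite_induct) auto

lemma to_fract_power: "to_fract (a ^ n) = to_fract a ^ n"
  by (induction n) auto

lemma to_fract_of_nat: "to_fract (of_nat n) = of_nat n"
  by (induction n) auto

lemma Const_mult: "Const (a * b) = Const a * Const b"
  by (simp add: Const_def mult_single)

lemma Const_of_nat: "Const (of_nat m) = of_nat m"
  unfolding Const_def by (rule single_of_nat)

lemma to_fract_Const_divide: "to_fract (Const (of_nat c / fact m)) = of_nat c / fact m"
proof -
  have "to_fract (Const (of_nat c / fact m)) * fact m
      = to_fract (Const (of_nat c / fact m) * Const (of_nat (fact m)))"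
    unfolding Const_of_nat to_fract_mult to_fract_of_nat by (simp only: of_nat_fact)
  also have "\<dots> = of_nat c"
    unfolding Const_mult[symmetric] by (simp add: Const_of_nat to_fract_of_nat)
  finally show ?thesis by (simp add: field_simps)
qed

lemma bij_betw_family_chains_Suc:
  "bij_betw (\<lambda>(\<A>, Bs). \<A> # Bs)
    (SIGMA \<A>:{\<A>. nested_family k {1..n} \<A>}. chains_below \<A> {1..n} l) (family_chains n k (Suc l))"
proof (rule bij_betwI')
  fix Cs assume "Cs \<in> family_chains n k (Suc l)"
  then show "\<exists>x\<in>(SIGMA \<A>:{\<A>. nested_family k {1..n} \<A>}. chains_below \<A> {1..n} l). Cs = (\<lambda>(\<A>, Bs). \<A> # Bs) x"
    by (cases Cs) (auto simp: family_chains_def chains_below_def dest: nested_familyD(4))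
next
  fix x assume "x \<in> (SIGMA \<A>:{\<A>. nested_family k {1..n} \<A>}. chains_below \<A> {1..n} l)"
  then show "(\<lambda>(\<A>, Bs). \<A> # Bs) x \<in> family_chains n k (Suc l)"
    by (auto simp: family_chains_def chains_below_def intro: nested_family_subset)
qed auto

text \<open>Regrouping the sum over dimension vectors as a sum over chains turns the exponents into
  differences of cardinalities. For a fixed first family the rest of the chain is summed by
  \<open>weighted_sum_chains_below\<close>.\<close>

lemma to_fract_exp_flag_poly_Pi_polytope:
  fixes x :: "nat \<Rightarrow> mpoly fract"
  defines "x \<equiv> \<lambda>i. to_fract (Var i)"
  assumes k: "2 \<le> k" "k \<le> n" and l: "1 \<le> l"
  shows "to_fract (exp_flag_poly l (Pi_polytope n k))
    = (\<Sum>\<A> | nested_family k {1..n} \<A>.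
        x 1 ^ (n - card \<A>) / fact (card \<A>) * ((\<Sum>i=2..l. x i) + 1) ^ (card \<A> - 1))"
proof -
  obtain l' where l': "l = Suc l'" using l by (cases l) auto
  \<comment> \<open>\<open>w s\<close> is the weight of a single flag, with indices shifted so that
    the exponent of \<open>x (i + 2)\<close> is the jump from entry \<open>i\<close> to entry
    \<open>i + 1\<close>.\<close>
  define w where "w s = x 1 ^ (s ! 0) / fact (n - 1 - s ! 0 + 1) *
      (\<Prod>i<l'. x (i + 2) ^ (s ! Suc i - s ! i))" for s
  let ?D = "map (\<lambda>\<A>::nat set set. n - card \<A>)"
  let ?S = "{s. length s = l \<and> sorted s \<and> set s \<subseteq> {0..n - 1}}"
  let ?NF = "{\<A>. nested_family k {1..n} \<A>}"
  have fS: "finite ?S"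
    by (rule finite_subset[OF _ finite_lists_length_eq[of "{0..n-1}" l]]) auto
  have card_pos: "1 \<le> card \<A>" "card \<A> \<le> n" if "nested_family k {1..n} \<A>" for \<A>
    using nested_familyD(4,10)[OF that] affine_dim_face_of_family(1)[OF that]
    by (auto simp: Suc_le_eq card_gt_0_iff)
  have mono: "to_fract (flag_monomial s) = x 1 ^ (s ! 0) * (\<Prod>i<l'. x (i + 2) ^ (s ! Suc i - s ! i))"
    if "length s = l" for s
  proof -
    have "(\<Prod>i=2..length s. x i ^ (s ! (i - 1) - s ! (i - 2))) = (\<Prod>i<l'. x (i + 2) ^ (s ! Suc i - s ! i))"
      by (rule prod.reindex_bij_witness[of _ "\<lambda>i. i + 2" "\<lambda>i. i - 2"])
        (use that l' in \<open>auto simp: Suc_diff_le numeral_2_eq_2 Suc_diff_Suc\<close>)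
    then show ?thesis by (simp add: flag_monomial_def x_def to_fract_prod to_fract_power)
  qed
  have "to_fract (exp_flag_poly l (Pi_polytope n k))
      = (\<Sum>s\<in>?S. of_nat (flag_number s (Pi_polytope n k)) * w s)"
    unfolding exp_flag_poly_def affine_dim_Pi_polytope[OF k] Let_def to_fract_sum nat_int
    by (intro sum.cong refl)
      (simp only: to_fract_mult to_fract_Const_divide mono w_def mem_Collect_eq mult.assoc
        mult.left_commute times_divide_eq_left times_divide_eq_right)
  also have "\<dots> = (\<Sum>s\<in>?S. \<Sum>Cs\<in>{Cs \<in> family_chains n k l. ?D Cs = s}. w (?D Cs))"
    by (intro sum.cong refl) (simp add: flag_number_Pi_polytope[OF k])
  also have "\<dots> = (\<Sum>Cs\<in>family_chains n k l. w (?D Cs))"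
  proof (rule sum.group[OF finite_family_chains fS], rule image_subsetI)
    fix Cs assume Cs: "Cs \<in> family_chains n k l"
    then have srt: "sorted_wrt (\<lambda>A B. B \<subseteq> A) Cs" and nf: "\<And>\<A>. \<A> \<in> set Cs \<Longrightarrow> nested_family k {1..n} \<A>"
      by (auto simp: family_chains_def)
    \<comment> \<open>The dimension vector is sorted because families shrink along the chain; its
      entries are at most \<open>n - 1\<close> because every family has a member.\<close>
    have "sorted (?D Cs)"
      unfolding sorted_map
      by (rule sorted_wrt_mono_rel[OF _ srt]) (use nf nested_familyD(10) card_mono in \<open>blast intro: diff_le_mono2\<close>)
    moreover have "n - card \<A> \<le> n - 1" if "\<A> \<in> set Cs" for \<A>
      using card_pos[OF nf[OF that]] by linarith
    ultimately show "?D Cs \<in> ?S" using Cs by (auto simp: family_chains_def)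
  qed
  also have "\<dots> = (\<Sum>(\<A>, Bs)\<in>(SIGMA \<A>:?NF. chains_below \<A> {1..n} l'). w (?D (\<A> # Bs)))"
    unfolding l' sum.reindex_bij_betw[OF bij_betw_family_chains_Suc, symmetric]
    by (intro sum.cong refl) auto
  also have "\<dots> = (\<Sum>\<A>\<in>?NF. \<Sum>Bs\<in>chains_below \<A> {1..n} l'. w (?D (\<A> # Bs)))"
    by (intro sum.Sigma[symmetric] ballI finite_chains_below finite_nested_families)
      (auto dest: nested_familyD(10))
  also have "\<dots> = (\<Sum>\<A>\<in>?NF. x 1 ^ (n - card \<A>) / fact (card \<A>) * ((\<Sum>i=2..l. x i) + 1) ^ (card \<A> - 1))"
  proof (intro sum.cong refl)
    fix \<A> assume "\<A> \<in> ?NF"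
    then have nf: "nested_family k {1..n} \<A>" by simp
    have w: "w (?D (\<A> # Bs)) = x 1 ^ (n - card \<A>) / fact (card \<A>) *
        (\<Prod>i<l'. x (i + 2) ^ (card ((\<A> # Bs) ! i) - card (Bs ! i)))"
      if Bs: "Bs \<in> chains_below \<A> {1..n} l'" for Bs
    proof -
      have len: "length Bs = l'" using Bs by (simp add: chains_below_def)
      have "\<A> # Bs \<in> family_chains n k (Suc l')"
        using bij_betwE[OF bij_betw_family_chains_Suc] nf Bs by fastforce
      then have "\<B> \<in> set (\<A> # Bs) \<Longrightarrow> card \<B> \<le> n" for \<B>
        using card_pos(2) unfolding family_chains_def by blast
      then have le: "card ((\<A> # Bs) ! i) \<le> n" if "i \<le> l'" for i
        using that len by (metis le_imp_less_Suc length_Cons nth_mem)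
      have "?D (\<A> # Bs) ! Suc i - ?D (\<A> # Bs) ! i = card ((\<A> # Bs) ! i) - card (Bs ! i)"
        if "i < l'" for i
      proof -
        have "?D (\<A> # Bs) ! Suc i = n - card (Bs ! i)" using that len by simp
        moreover have "?D (\<A> # Bs) ! i = n - card ((\<A> # Bs) ! i)"
          using that len by (subst nth_map) auto
        ultimately show ?thesis using le[of i] le[of "Suc i"] that by simp
      qed
      \<comment> \<open>The factorial argument \<open>d - s ! 0 + 1\<close> becomes the size of the
        first family.\<close>
      moreover have "n - 1 - (n - card \<A>) + 1 = card \<A>" using card_pos[OF nf] by linarith
      ultimately show ?thesis unfolding w_def by simp
    qed
    have "(\<Sum>i<l'. x (i + 2)) = (\<Sum>i=2..l. x i)"
      by (rule sum.reindex_bij_witness[of _ "\<lambda>i. i - 2" "\<lambda>i. i + 2"]) (use l' in auto)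
    moreover have "finite \<A>" "{1..n} \<in> \<A>" using nested_familyD(4,10)[OF nf] by auto
    ultimately have "(\<Sum>Bs\<in>chains_below \<A> {1..n} l'.
          \<Prod>i<l'. x (i + 2) ^ (card ((\<A> # Bs) ! i) - card (Bs ! i)))
        = ((\<Sum>i=2..l. x i) + 1) ^ (card \<A> - 1)"
      using weighted_sum_chains_below[of \<A> "{1..n}", where l = l' and z = "\<lambda>i. x (i + 2)"]
      by simp
    moreover have "(\<Sum>Bs\<in>chains_below \<A> {1..n} l'. w (?D (\<A> # Bs)))
        = x 1 ^ (n - card \<A>) / fact (card \<A>) * (\<Sum>Bs\<in>chains_below \<A> {1..n} l'.
          \<Prod>i<l'. x (i + 2) ^ (card ((\<A> # Bs) ! i) - card (Bs ! i)))"
      unfolding sum_distrib_left by (intro sum.cong refl w)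
    ultimately show "(\<Sum>Bs\<in>chains_below \<A> {1..n} l'. w (?D (\<A> # Bs)))
        = x 1 ^ (n - card \<A>) / fact (card \<A>) * ((\<Sum>i=2..l. x i) + 1) ^ (card \<A> - 1)"
      by simp
  qed
  finally show ?thesis .
qed

section \<open>Counting nested families\<close>

text \<open>There are \<open>r\<close> singletons and \<open>m + 1\<close> large members, the extra
  one being \<open>X\<close> itself.\<close>

definition graded_families :: "nat \<Rightarrow> nat \<Rightarrow> nat \<Rightarrow> 'a set \<Rightarrow> 'a set set set" where
  "graded_families k r m X =
     {\<A>. nested_family k X \<A> \<and> card {i. {i} \<in> \<A>} = r \<and> card \<A> = Suc (r + m)}"

text \<open>The recursion removes the ground set of size \<open>n\<close> and continues with the
  largest remaining large member, of size \<open>j\<close>; at the bottom only the \<open>r\<close>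
  singletons have to be chosen.\<close>

fun family_count :: "nat \<Rightarrow> nat \<Rightarrow> nat \<Rightarrow> nat \<Rightarrow> nat" where
  "family_count k r 0 n = (if k \<le> n then n choose r else 0)"
| "family_count k r (Suc m) n = (\<Sum>j<n. (n choose j) * family_count k r m j)"

lemma card_nested_family:
  assumes nf: "nested_family k X \<A>"
  shows "card \<A> = card {i. {i} \<in> \<A>} + card {A \<in> \<A>. k \<le> card A}"
proof -
  note D = nested_familyD[OF nf]
  have "\<A> = (\<lambda>i. {i}) ` {i. {i} \<in> \<A>} \<union> {A \<in> \<A>. k \<le> card A}"
    using D(8) by (auto simp: card_1_singleton_iff)
  moreover have "(\<lambda>i. {i}) ` {i. {i} \<in> \<A>} \<inter> {A \<in> \<A>. k \<le> card A} = {}"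
    using D(2) by auto
  moreover have "card ((\<lambda>i. {i}) ` {i. {i} \<in> \<A>}) = card {i. {i} \<in> \<A>}"
    by (intro card_image inj_onI) simp
  ultimately show ?thesis using D(10,11) card_Un_disjoint[of "(\<lambda>i. {i}) ` {i. {i} \<in> \<A>}" "{A \<in> \<A>. k \<le> card A}"]
    by simp
qed

lemma bij_betw_graded_families_0:
  assumes X: "finite X" "2 \<le> k" "k \<le> card X" "r < k"
  shows "bij_betw (\<lambda>R. insert X ((\<lambda>i. {i}) ` R)) {R. R \<subseteq> X \<and> card R = r} (graded_families k r 0 X)"
proof (rule bij_betw_byWitness[where f' = "\<lambda>\<A>. {i. {i} \<in> \<A>}"])
  have X1: "X \<noteq> {i}" for i using X by auto
  show "\<forall>R\<in>{R. R \<subseteq> X \<and> card R = r}. {i. {i} \<in> insert X ((\<lambda>i. {i}) ` R)} = R"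
    using X1 by auto
  show "(\<lambda>R. insert X ((\<lambda>i. {i}) ` R)) ` {R. R \<subseteq> X \<and> card R = r} \<subseteq> graded_families k r 0 X"
  proof (rule image_subsetI)
    fix R assume "R \<in> {R. R \<subseteq> X \<and> card R = r}"
    then have R: "R \<subseteq> X" "card R = r" by auto
    let ?A = "insert X ((\<lambda>i. {i}) ` R)"
    have finR: "finite R" using R X finite_subset by blast
    have s: "{i. {i} \<in> ?A} = R" using X1 by auto
    have "A \<subseteq> B \<or> B \<subseteq> A" if AB: "A \<in> ?A" "B \<in> ?A" "k \<le> card (A \<union> B)" for A B
    proof (cases "A = X \<or> B = X")
      case False
      then obtain a b where ab: "a \<in> R" "b \<in> R" "A = {a}" "B = {b}" using AB by auto
      show ?thesis
      proof (cases "a = b")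
        case False
        \<comment> \<open>Two distinct singletons force \<open>2 \<le> r < k\<close>, so their union
          is too small for the comparability condition to apply.\<close>
        then have "2 \<le> r" using card_mono[OF finR, of "{a, b}"] ab R by auto
        moreover have "card (A \<union> B) = 2" using ab False by auto
        ultimately show ?thesis using AB X by linarith
      qed (use ab in simp)
    qed (use AB R in auto)
    moreover have "X \<notin> (\<lambda>i. {i}) ` R" using X1 by auto
    then have "card ?A = Suc r"
      using finR R card_image[of "\<lambda>i. {i}" R] by (simp add: inj_on_def)
    ultimately show "?A \<in> graded_families k r 0 X"
      using X R s unfolding graded_families_def nested_family_def by auto
  qed
  show "(\<lambda>\<A>. {i. {i} \<in> \<A>}) ` graded_families k r 0 X \<subseteq> {R. R \<subseteq> X \<and> card R = r}"
    by (auto simp: graded_families_def dest: nested_familyD(6))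
  show "\<forall>\<A>\<in>graded_families k r 0 X. insert X ((\<lambda>i. {i}) ` {i. {i} \<in> \<A>}) = \<A>"
  proof
    fix \<A> assume "\<A> \<in> graded_families k r 0 X"
    then have nf: "nested_family k X \<A>" and c: "card {i. {i} \<in> \<A>} = r" "card \<A> = Suc r"
      by (auto simp: graded_families_def)
    note D = nested_familyD[OF nf]
    have "card {A \<in> \<A>. k \<le> card A} = 1" using card_nested_family[OF nf] c by simp
    moreover have "X \<in> {A \<in> \<A>. k \<le> card A}" using D by simp
    ultimately have "{A \<in> \<A>. k \<le> card A} = {X}" by (metis card_1_singletonE singletonD)
    then have "A \<in> insert X ((\<lambda>i. {i}) ` {i. {i} \<in> \<A>})" if "A \<in> \<A>" for A
      using D(8)[OF that] that by (auto simp: card_1_singleton_iff)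
    then show "insert X ((\<lambda>i. {i}) ` {i. {i} \<in> \<A>}) = \<A>" using D(4) by blast
  qed
qed

text \<open>Removing \<open>X\<close> leaves a family whose largest large member \<open>C\<close>
  contains everything else and serves as the new ground set; \<open>C\<close> can be read off from
  that family.\<close>

lemma bij_betw_graded_families_Suc:
  assumes X: "finite X" "2 \<le> k"
  shows "bij_betw (\<lambda>(C, \<A>). insert X \<A>) (SIGMA C:{C. C \<subset> X}. graded_families k r m C)
    (graded_families k r (Suc m) X)"
proof (rule bij_betwI')
  have notin: "X \<notin> \<A>" if "C \<subset> X" "\<A> \<in> graded_families k r m C" for C \<A>
    using that nested_familyD(6) by (fastforce simp: graded_families_def)
  {
    fix x y assume x: "x \<in> (SIGMA C:{C. C \<subset> X}. graded_families k r m C)"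
      and y: "y \<in> (SIGMA C:{C. C \<subset> X}. graded_families k r m C)"
    obtain C \<A> D \<B> where xy: "x = (C, \<A>)" "y = (D, \<B>)" by (cases x, cases y) auto
    have C: "C \<subset> X" "\<A> \<in> graded_families k r m C" and D: "D \<subset> X" "\<B> \<in> graded_families k r m D"
      using x y by (auto simp: xy)
    have "x = y" if "insert X \<A> = insert X \<B>"
    proof -
      have AB: "\<A> = \<B>" using that notin[OF C] notin[OF D] by (metis insert_ident)
      have "nested_family k C \<A>" "nested_family k D \<A>"
        using C(2) D(2) AB by (auto simp: graded_families_def)
      then have "C = D" using nested_familyD(4,6) by (metis subset_antisym)
      then show ?thesis using AB xy by simp
    qed
    then show "((\<lambda>(C, \<A>). insert X \<A>) x = (\<lambda>(C, \<A>). insert X \<A>) y) = (x = y)"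
      by (auto simp: xy)
  next
    fix x assume x: "x \<in> (SIGMA C:{C. C \<subset> X}. graded_families k r m C)"
    obtain C \<A> where xC: "x = (C, \<A>)" by (cases x) auto
    have C: "C \<subset> X" "\<A> \<in> graded_families k r m C" using x by (auto simp: xC)
    have nf: "nested_family k C \<A>" and c: "card {i. {i} \<in> \<A>} = r" "card \<A> = Suc (r + m)"
      using C(2) by (auto simp: graded_families_def)
    note D = nested_familyD[OF nf]
    have "card C < card X" using psubset_card_mono[OF X(1) C(1)] .
    then have kX: "k \<le> card X" using D(3) by linarith
    then have X1: "X \<noteq> {i}" for i using X(2) by auto
    have s: "{i. {i} \<in> insert X \<A>} = {i. {i} \<in> \<A>}" using X1 by auto
    have sub: "A \<subseteq> X" if "A \<in> \<A>" for A using D(6)[OF that] C(1) by blast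
    have "nested_family k X (insert X \<A>)"
      unfolding nested_family_def s
    proof (intro conjI ballI impI)
      fix A B assume "A \<in> insert X \<A>" "B \<in> insert X \<A>" "k \<le> card (A \<union> B)"
      then show "A \<subseteq> B \<or> B \<subseteq> A" using D(9) sub by blast
    qed (use X kX D(5,8) sub in auto)
    then show "(\<lambda>(C, \<A>). insert X \<A>) x \<in> graded_families k r (Suc m) X"
      using notin[OF C] D(10) c s by (simp add: xC graded_families_def)
  next
    fix \<A>' assume "\<A>' \<in> graded_families k r (Suc m) X"
    then have nf: "nested_family k X \<A>'" and c: "card {i. {i} \<in> \<A>'} = r" "card \<A>' = Suc (r + Suc m)"
      by (auto simp: graded_families_def)
    note D = nested_familyD[OF nf]
    define \<A> where "\<A> = \<A>' - {X}"
    define \<F> where "\<F> = {A \<in> \<A>. k \<le> card A}"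
    have "card {A \<in> \<A>'. k \<le> card A} = Suc (Suc m)" using card_nested_family[OF nf] c by simp
    moreover have "{A \<in> \<A>'. k \<le> card A} = insert X \<F>" "X \<notin> \<F>" using D(3,4) by (auto simp: \<F>_def \<A>_def)
    moreover have fF: "finite \<F>" using D(10) by (simp add: \<F>_def \<A>_def)
    ultimately have "\<F> \<noteq> {}" by auto
    with fF obtain C where C: "C \<in> \<F>" "\<And>A. A \<in> \<F> \<Longrightarrow> A \<subseteq> C"
      by (rule finite_chain_has_max)
        (use nested_family_comparable[OF nf] in \<open>auto simp: \<F>_def \<A>_def\<close>)
    have C': "C \<in> \<A>'" "C \<noteq> X" "k \<le> card C" using C(1) by (auto simp: \<F>_def \<A>_def)
    have CX: "C \<subset> X" using C' D(6) by blast
    have sub: "A \<subseteq> C" if A: "A \<in> \<A>" for A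
    proof (cases "k \<le> card A")
      case False
      have A': "A \<in> \<A>'" using A by (simp add: \<A>_def)
      have "card A < card C" using False C'(3) by linarith
      then have "\<not> C \<subseteq> A" using card_mono[OF D(7)[OF A'], of C] by linarith
      then show ?thesis using nested_family_comparable[OF nf C'(1) A' C'(3)] by blast
    qed (use A C(2) in \<open>auto simp: \<F>_def\<close>)
    have s: "{i. {i} \<in> \<A>} = {i. {i} \<in> \<A>'}" using D(2,3) by (auto simp: \<A>_def)
    have "nested_family k C \<A>"
      unfolding nested_family_def s
    proof (intro conjI ballI impI)
      fix A B assume "A \<in> \<A>" "B \<in> \<A>" "k \<le> card (A \<union> B)"
      then show "A \<subseteq> B \<or> B \<subseteq> A" using D(9) unfolding \<A>_def by blast
    qed (use D(2,5,8) D(7)[OF C'(1)] C' sub in \<open>auto simp: \<A>_def\<close>)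
    moreover have "card \<A> = Suc (r + m)" using c D(4) by (simp add: \<A>_def)
    ultimately have "(C, \<A>) \<in> (SIGMA C:{C. C \<subset> X}. graded_families k r m C)"
      using CX c(1) s by (simp add: graded_families_def)
    moreover have "\<A>' = (\<lambda>(C, \<A>). insert X \<A>) (C, \<A>)" using D(4) by (auto simp: \<A>_def)
    ultimately show "\<exists>x\<in>(SIGMA C:{C. C \<subset> X}. graded_families k r m C). \<A>' = (\<lambda>(C, \<A>). insert X \<A>) x"
      by (rule bexI[rotated])
  }
qed

lemma finite_graded_families: "finite (graded_families k r m X)"
proof (cases "finite X")
  case True
  have "graded_families k r m X \<subseteq> Pow (Pow X)"
    by (auto simp: graded_families_def dest: nested_familyD(6))
  then show ?thesis using True finite_subset by blast
qed (simp add: graded_families_def nested_family_def)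

lemma card_graded_families:
  assumes "finite X" "2 \<le> k" "r < k"
  shows "card (graded_families k r m X) = family_count k r m (card X)"
  using assms(1)
proof (induction m arbitrary: X)
  case 0
  show ?case
  proof (cases "k \<le> card X")
    case True
    then show ?thesis
      using bij_betw_same_card[OF bij_betw_graded_families_0[OF 0 assms(2) True assms(3)]] n_subsets[OF 0]
      by simp
  next
    case False
    then have "graded_families k r 0 X = {}" by (auto simp: graded_families_def nested_family_def)
    then show ?thesis using False by simp
  qed
next
  case (Suc m)
  have fin: "finite {C. C \<subset> X}" using Suc.prems by (simp add: psubset_eq)
  have "card (graded_families k r (Suc m) X) = card (SIGMA C:{C. C \<subset> X}. graded_families k r m C)"
    using bij_betw_same_card[OF bij_betw_graded_families_Suc[OF Suc.prems assms(2)]] by metis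
  also have "\<dots> = (\<Sum>C | C \<subset> X. card (graded_families k r m C))"
    using fin finite_graded_families by (intro card_SigmaI) blast+
  also have "\<dots> = (\<Sum>C | C \<subset> X. family_count k r m (card C))"
    using Suc.prems by (intro sum.cong refl Suc.IH) (auto intro: finite_subset)
  also have "\<dots> = (\<Sum>j<card X. \<Sum>C\<in>{C \<in> {C. C \<subset> X}. card C = j}. family_count k r m (card C))"
    using fin psubset_card_mono[OF Suc.prems] by (intro sum.group[symmetric]) auto
  also have "\<dots> = (\<Sum>j<card X. (card X choose j) * family_count k r m j)"
  proof (intro sum.cong refl)
    fix j assume "j \<in> {..<card X}"
    then have "{C \<in> {C. C \<subset> X}. card C = j} = {C. C \<subseteq> X \<and> card C = j}" by auto
    then have "card {C \<in> {C. C \<subset> X}. card C = j} = card X choose j"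
      using n_subsets[OF Suc.prems] by simp
    then show "(\<Sum>C\<in>{C \<in> {C. C \<subset> X}. card C = j}. family_count k r m (card C))
        = (card X choose j) * family_count k r m j" by simp
  qed
  finally show ?case by simp
qed

lemma family_count_eq_0: "n < k \<Longrightarrow> family_count k r m n = 0"
  by (induction m arbitrary: n) auto

text \<open>The smallest large member has at least \<open>k > r\<close> points, and each of the
  \<open>m\<close> others is strictly larger than the one before, so \<open>n > r + m\<close> is
  needed. This disposes of the terms where \<open>n - Suc (r + m)\<close> is truncated.\<close>

lemma family_count_eq_0': "r < k \<Longrightarrow> n \<le> r + m \<Longrightarrow> family_count k r m n = 0"
proof (induction m arbitrary: n)
  case (Suc m)
  then have "family_count k r m j = 0" if "j < n" for j using that by simp
  then show ?case by simp
qed auto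

section \<open>Exponential generating functions of the counts\<close>

lemma fps_const_mult_X_power_nth:
  "((fps_const c * fps_X) ^ r * f) $ n = (if n < r then 0 else c ^ r * f $ (n - r))"
  for c :: "'a::comm_ring_1"
  by (simp add: power_mult_distrib mult.assoc fps_const_power fps_X_power_mult_nth)

lemma trunc_exp_nth:
  "trunc_exp m (fps_const c * fps_X) $ i = (if i \<le> m then c ^ i / fact i else 0)"
proof -
  have "((fps_const c * fps_X) ^ j :: 'a fps) $ i = (if i = j then c ^ i else 0)" for j
    using fps_const_mult_X_power_nth[of c j 1 i] by auto
  then show ?thesis
    by (simp add: trunc_exp_def fps_sum_nth if_distrib[of "\<lambda>a. a / _"] cong: if_cong)
qed

text \<open>A base family is a choice of \<open>r\<close> singletons together with at least
  \<open>k - r\<close> other points, which explains the truncated exponential; every further ground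
  set adds a nonempty set of new points, hence a factor \<open>fps_exp c - 1\<close>.\<close>

lemma family_count_egf:
  fixes c :: "'a::field_char_0"
  assumes "r < k"
  shows "Abs_fps (\<lambda>n. of_nat (family_count k r m n) * c ^ n / fact n)
    = fps_const (1 / fact r) * ((fps_const c * fps_X) ^ r *
        (fps_exp c - trunc_exp (k - r - 1) (fps_const c * fps_X))) * (fps_exp c - 1) ^ m"
proof (induction m)
  case 0
  show ?case
  proof (rule fps_ext)
    fix n
    let ?rhs = "fps_const (1 / fact r) * ((fps_const c * fps_X) ^ r *
        (fps_exp c - trunc_exp (k - r - 1) (fps_const c * fps_X))) * (fps_exp c - 1) ^ 0"
    have rhs: "?rhs $ n = 1 / fact r * (if n < r then 0 else c ^ r *
        (c ^ (n - r) / fact (n - r) - (if n - r \<le> k - r - 1 then c ^ (n - r) / fact (n - r) else 0)))"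
      by (simp only: power_0 mult_1_right fps_mult_left_const_nth fps_const_mult_X_power_nth
          fps_sub_nth fps_exp_nth trunc_exp_nth of_nat_fact)
    show "Abs_fps (\<lambda>n. of_nat (family_count k r 0 n) * c ^ n / fact n) $ n = ?rhs $ n"
    proof (cases "k \<le> n")
      case True
      then have rn: "r \<le> n" and "\<not> n - r \<le> k - r - 1" using assms by auto
      moreover have "c ^ r * c ^ (n - r) = c ^ n" using rn by (simp flip: power_add)
      ultimately show ?thesis
        unfolding rhs using True by (simp add: binomial_fact)
    next
      case False
      then have "n < r \<or> n - r \<le> k - r - 1" by linarith
      then show ?thesis unfolding rhs using False by auto
    qed
  qed
next
  case (Suc m)
  have "Abs_fps (\<lambda>n. of_nat (family_count k r (Suc m) n) * c ^ n / fact n)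
      = Abs_fps (\<lambda>n. of_nat (family_count k r m n) * c ^ n / fact n) * (fps_exp c - 1)"
  proof (rule fps_ext)
    fix n
    have "(Abs_fps (\<lambda>n. of_nat (family_count k r m n) * c ^ n / fact n) * (fps_exp c - 1)) $ n
        = (\<Sum>j\<le>n. of_nat (family_count k r m j) * c ^ j / fact j * (fps_exp c - 1) $ (n - j))"
      by (simp add: fps_mult_nth atLeast0AtMost)
    \<comment> \<open>The term \<open>j = n\<close> drops out because \<open>fps_exp c - 1\<close>
      has no constant term.\<close>
    also have "\<dots> = (\<Sum>j<n. of_nat (family_count k r m j) * c ^ j / fact j * (fps_exp c - 1) $ (n - j))"
      by (simp add: lessThan_Suc_atMost[symmetric] mult.commute)
    also have "\<dots> = (\<Sum>j<n. of_nat ((n choose j) * family_count k r m j) * c ^ n / fact n)"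
    proof (intro sum.cong refl)
      fix j assume "j \<in> {..<n}"
      then have j: "j < n" by simp
      have "c ^ j * c ^ (n - j) = c ^ n" using j by (simp flip: power_add)
      moreover have "(fps_exp c - 1) $ (n - j) = c ^ (n - j) / fact (n - j)" using j by simp
      moreover have "of_nat (n choose j) = (fact n / (fact j * fact (n - j)) :: 'a)"
        using j by (simp add: binomial_fact)
      ultimately show "of_nat (family_count k r m j) * c ^ j / fact j * (fps_exp c - 1) $ (n - j)
          = of_nat ((n choose j) * family_count k r m j) * c ^ n / fact n"
        by (simp add: field_simps)
    qed
    finally show "Abs_fps (\<lambda>n. of_nat (family_count k r (Suc m) n) * c ^ n / fact n) $ n
      = (Abs_fps (\<lambda>n. of_nat (family_count k r m n) * c ^ n / fact n) * (fps_exp c - 1)) $ n"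
      by (simp add: sum_distrib_right sum_divide_distrib)
  qed
  then show ?case unfolding Suc.IH by (simp add: mult_ac)
qed

text \<open>Powers \<open>h ^ m\<close> with \<open>m > n\<close> vanish up to degree
  \<open>n\<close>, so the infinite expansion of \<open>g\<close> in powers of \<open>h\<close>
  becomes a finite sum.\<close>

lemma fps_mult_compose_nth:
  fixes f g h :: "'a::field_char_0 fps"
  assumes "h $ 0 = 0"
  shows "(f * (g oo h)) $ n = (\<Sum>m\<le>n. g $ m * (f * h ^ m) $ n)"
proof -
  have c: "(g oo h) $ p = (\<Sum>m\<le>n. g $ m * (h ^ m) $ p)" if "p \<le> n" for p
    unfolding fps_compose_nth
    by (rule sum.mono_neutral_left) (use that startsby_zero_power_prefix[OF assms] in auto)
  have "(f * (g oo h)) $ n = (\<Sum>i=0..n. \<Sum>m\<le>n. g $ m * (f $ i * (h ^ m) $ (n - i)))"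
    unfolding fps_mult_nth by (intro sum.cong refl) (simp add: c sum_distrib_left mult_ac)
  also have "\<dots> = (\<Sum>m\<le>n. \<Sum>i=0..n. g $ m * (f $ i * (h ^ m) $ (n - i)))" by (rule sum.swap)
  also have "\<dots> = (\<Sum>m\<le>n. g $ m * (f * h ^ m) $ n)" by (simp add: fps_mult_nth sum_distrib_left)
  finally show ?thesis .
qed

text \<open>The tail of the exponential series begins in degree \<open>r + 1\<close>, so that power
  of \<open>t\<close> splits off; it will cancel the power of \<open>fps_exp c - 1\<close> in the
  denominator.\<close>

lemma exp_compose_minus_trunc_exp:
  fixes t :: "'a::field_char_0 fps"
  assumes "t $ 0 = 0"
  shows "(fps_exp 1 oo t) - trunc_exp r t = t ^ Suc r * (Abs_fps (\<lambda>m. 1 / fact (r + m + 1)) oo t)"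
proof -
  let ?g = "Abs_fps (\<lambda>m. 1 / fact (r + m + 1)) :: 'a fps"
  have "fps_exp 1 = trunc_exp r fps_X + fps_X ^ Suc r * ?g"
  proof (rule fps_ext)
    fix n
    show "fps_exp 1 $ n = (trunc_exp r fps_X + fps_X ^ Suc r * ?g) $ n"
    proof (cases "n \<le> r")
      case False
      then obtain m where "n = Suc (r + m)" by (metis less_iff_Suc_add not_le)
      then show ?thesis
        using trunc_exp_nth[of r "1::'a"] by (simp add: fps_X_power_mult_nth algebra_simps del: power_Suc)
    qed (use trunc_exp_nth[of r "1::'a"] in \<open>simp add: fps_X_power_mult_nth del: power_Suc\<close>)
  qed
  then have "fps_exp 1 oo t = (trunc_exp r fps_X oo t) + (fps_X oo t) ^ Suc r * (?g oo t)"
    using assms by (simp only: fps_compose_add_distrib fps_compose_mult_distrib fps_compose_power)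
  also have "trunc_exp r fps_X oo t = trunc_exp r t"
    using assms by (simp add: trunc_exp_def fps_compose_sum_distrib fps_compose_mult_distrib
        flip: fps_compose_power)
  also have "fps_X oo t = t" using assms by simp
  finally show ?thesis by simp
qed

section \<open>The generating function\<close>

lemma sum_nested_families_by_grade:
  fixes h :: "nat \<Rightarrow> 'b::semiring_1"
  assumes k: "2 \<le> k" and X: "finite X"
    and le: "\<And>\<A>. nested_family k X \<A> \<Longrightarrow> card \<A> \<le> n"
  shows "(\<Sum>\<A> | nested_family k X \<A>. h (card \<A>))
    = (\<Sum>r<k. \<Sum>m\<le>n. of_nat (family_count k r m (card X)) * h (Suc (r + m)))"
proof -
  define g where "g \<A> = (card {i. {i} \<in> \<A>}, card \<A> - Suc (card {i. {i} \<in> \<A>}))" for \<A> :: "'a set set"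
  have gr: "card \<A> = Suc (fst (g \<A>) + snd (g \<A>))" if nf: "nested_family k X \<A>" for \<A>
  proof -
    note D = nested_familyD[OF nf]
    have "X \<in> {A \<in> \<A>. k \<le> card A}" "finite {A \<in> \<A>. k \<le> card A}" using D by auto
    then have "0 < card {A \<in> \<A>. k \<le> card A}" by (auto simp: card_gt_0_iff)
    then show ?thesis using card_nested_family[OF nf] by (simp add: g_def)
  qed
  have fib: "{\<A> \<in> {\<A>. nested_family k X \<A>}. g \<A> = (r, m)} = graded_families k r m X" for r m
    using gr by (fastforce simp: graded_families_def g_def)
  have "(\<Sum>\<A> | nested_family k X \<A>. h (card \<A>))
      = (\<Sum>y\<in>{..<k} \<times> {..n}. \<Sum>\<A>\<in>{\<A> \<in> {\<A>. nested_family k X \<A>}. g \<A> = y}. h (card \<A>))"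
  proof (rule sum.group[symmetric])
    show "g ` {\<A>. nested_family k X \<A>} \<subseteq> {..<k} \<times> {..n}"
      using le nested_familyD(5) by (fastforce simp: g_def)
  qed (auto intro: finite_nested_families)
  also have "\<dots> = (\<Sum>(r, m)\<in>{..<k} \<times> {..n}. of_nat (family_count k r m (card X)) * h (Suc (r + m)))"
  proof (intro sum.cong refl)
    fix y assume "y \<in> {..<k} \<times> {..n}"
    then obtain r m where y: "y = (r, m)" "r < k" by auto
    have "(\<Sum>\<A>\<in>graded_families k r m X. h (card \<A>)) = (\<Sum>\<A>\<in>graded_families k r m X. h (Suc (r + m)))"
      by (intro sum.cong refl) (simp add: graded_families_def)
    then show "(\<Sum>\<A>\<in>{\<A> \<in> {\<A>. nested_family k X \<A>}. g \<A> = y}. h (card \<A>))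
        = (case y of (r, m) \<Rightarrow> of_nat (family_count k r m (card X)) * h (Suc (r + m)))"
      using card_graded_families[OF X k y(2), of m] unfolding y(1) fib by simp
  qed
  finally show ?thesis by (simp add: sum.cartesian_product)
qed

lemma Var_neq_0: "Var i \<noteq> 0"
  unfolding Var_def by (metis lookup_single_eq lookup_zero zero_neq_one)

text \<open>The constant coefficient is 1. This makes \<open>S\<close> invertible in the fraction
  field.\<close>

lemma sum_Var_plus_1_neq_0: "(\<Sum>i\<in>I. Var i) + 1 \<noteq> 0"
proof
  have ne: "Poly_Mapping.single i (Suc 0) \<noteq> 0" for i :: nat
    by (metis lookup_single_eq lookup_zero nat.distinct(1))
  assume "(\<Sum>i\<in>I. Var i) + 1 = 0"
  then have "lookup ((\<Sum>i\<in>I. Var i) + 1) 0 = 0" by simp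
  then show False
    by (simp add: lookup_add Poly_Mapping.lookup_sum Var_def lookup_single when_def ne)
qed

text \<open>With \<open>c = r + m + 1\<close>, the weight \<open>x 1 ^ (n - c) * S ^ (c - 1)\<close>
  equals \<open>x 1 ^ n * (S / x 1) ^ c / S\<close>; the powers of \<open>S / x 1\<close> match the
  expansion of the exponential of \<open>T\<close>.\<close>

lemma coeff_eq_family_count_sum:
  fixes k l n :: nat and x :: "nat \<Rightarrow> mpoly fract"
  defines "x \<equiv> \<lambda>i. to_fract (Var i)"
  defines "S \<equiv> (\<Sum>i=2..l. x i) + 1"
  assumes k: "2 \<le> k" and l: "1 \<le> l"
  shows "(if k \<le> n then to_fract (exp_flag_poly l (Pi_polytope n k)) / fact n else 0)
    = 1 / S * (\<Sum>r<k. \<Sum>m\<le>n. (S / x 1) ^ Suc (r + m) / fact (Suc (r + m)) *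
        (of_nat (family_count k r m n) * x 1 ^ n / fact n))"
proof (cases "k \<le> n")
  case True
  have x0: "x 1 \<noteq> 0" by (simp add: x_def Var_neq_0)
  have "S = to_fract ((\<Sum>i=2..l. Var i) + 1)" by (simp add: S_def x_def)
  then have S0: "S \<noteq> 0"
    using sum_Var_plus_1_neq_0 by (simp only: to_fract_eq_0_iff not_False_eq_True)
  have "to_fract (exp_flag_poly l (Pi_polytope n k))
      = (\<Sum>r<k. \<Sum>m\<le>n. of_nat (family_count k r m n) *
          (x 1 ^ (n - Suc (r + m)) / fact (Suc (r + m)) * S ^ (r + m)))"
    using to_fract_exp_flag_poly_Pi_polytope[OF k True l]
      sum_nested_families_by_grade[OF k, of "{1..n}" n "\<lambda>c. x 1 ^ (n - c) / fact c * S ^ (c - 1)"]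
      affine_dim_face_of_family(1)
    by (simp add: x_def S_def)
  also have "\<dots> = (\<Sum>r<k. \<Sum>m\<le>n. fact n / S * ((S / x 1) ^ Suc (r + m) / fact (Suc (r + m)) *
        (of_nat (family_count k r m n) * x 1 ^ n / fact n)))"
  proof (intro sum.cong refl)
    fix r m assume r: "r \<in> {..<k}"
    show "of_nat (family_count k r m n) *
          (x 1 ^ (n - Suc (r + m)) / fact (Suc (r + m)) * S ^ (r + m))
        = fact n / S * ((S / x 1) ^ Suc (r + m) / fact (Suc (r + m)) *
        (of_nat (family_count k r m n) * x 1 ^ n / fact n))"
    proof (cases "n \<le> r + m")
      \<comment> \<open>Here the exponent \<open>n - Suc (r + m)\<close> is truncated to 0, but
        there are no such families.\<close>
      case True
      then show ?thesis using r family_count_eq_0'[of r k n m] by simp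
    next
      case False
      then have "x 1 ^ n = x 1 ^ (n - Suc (r + m)) * x 1 ^ Suc (r + m)"
        by (simp flip: power_add del: power_Suc)
      moreover have "S ^ Suc (r + m) = S * S ^ (r + m)" by simp
      ultimately show ?thesis
        using S0 x0 by (simp add: power_divide del: power_Suc fact_Suc)
    qed
  qed
  finally have "to_fract (exp_flag_poly l (Pi_polytope n k))
      = fact n / S * (\<Sum>r<k. \<Sum>m\<le>n. (S / x 1) ^ Suc (r + m) / fact (Suc (r + m)) *
        (of_nat (family_count k r m n) * x 1 ^ n / fact n))"
    by (simp only: sum_distrib_left)
  then show ?thesis using True by (simp only: if_True) simp
next
  case False
  then show ?thesis by (simp add: family_count_eq_0)
qed

text \<open>Once the exponential tail is written as \<open>T ^ Suc r\<close> times a series in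
  \<open>T\<close>, the denominator cancels, and the powers of \<open>T\<close> in that series
  produce the generating functions for all \<open>m\<close>.\<close>

lemma rhs_summand_nth:
  fixes c s :: "'a::field_char_0" and xy T :: "'a fps"
  assumes "r < k" and c0: "c \<noteq> 0"
  defines "xy \<equiv> fps_const c * fps_X"
  defines "T \<equiv> fps_const s * (fps_exp c - 1)"
  shows "(xy ^ r * (fps_exp c - trunc_exp (k - r - 1) xy)
            / (fps_const (fact r) * (fps_exp c - 1) ^ (r + 1))
          * ((fps_exp 1 oo T) - trunc_exp r T)) $ n
    = (\<Sum>m\<le>n. s ^ Suc (r + m) / fact (Suc (r + m)) * (of_nat (family_count k r m n) * c ^ n / fact n))"
proof -
  define u where "u = fps_exp c - 1"
  define A where "A = xy ^ r * (fps_exp c - trunc_exp (k - r - 1) xy)"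
  define B where "B = fps_const (fact r) * u ^ (r + 1)"
  define G where "G = (Abs_fps (\<lambda>m. 1 / fact (r + m + 1)) :: 'a fps)"
  define f where "f m = Abs_fps (\<lambda>n. of_nat (family_count k r m n) * c ^ n / fact n)" for m
  have egf: "f m = fps_const (1 / fact r) * A * u ^ m" for m
    unfolding f_def A_def u_def xy_def by (rule family_count_egf[OF assms(1)])
  have u1: "u $ 1 = c" by (simp add: u_def)
  have u0: "u $ 0 = 0" by (simp add: u_def)
  have su: "subdegree u = 1" using u0 u1 c0 by (intro subdegreeI) auto
  have une: "u \<noteq> 0" using u1 c0 by auto
  have A_eq: "A = fps_const (fact r) * f 0"
    by (simp add: egf mult.assoc[symmetric])
  \<comment> \<open>The quotient of power series is exact only under divisibility: \<open>A\<close>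
    vanishes below degree \<open>k\<close>, while the denominator \<open>B\<close> starts in degree
    \<open>r + 1 \<le> k\<close>.\<close>
  have "B dvd A"
  proof (cases "A = 0")
    case False
    have "A $ i = 0" if "i < k" for i using that by (simp add: A_eq f_def)
    then have "k \<le> subdegree A" using False by (intro subdegree_geI) auto
    moreover have "subdegree B = r + 1" using su une by (simp add: B_def subdegree_power)
    moreover have "B \<noteq> 0" using une by (simp add: B_def)
    ultimately show ?thesis using False assms(1) by (subst fps_dvd_iff) auto
  qed simp
  then have AB: "A / B * B = A" by (rule dvd_div_mult_self)
  have "fps_const (1 / fact r :: 'a) * fps_const (fact r) = 1" by simp
  then have uB: "u ^ Suc r = fps_const (1 / fact r) * B" by (simp add: B_def mult.assoc[symmetric])
  have T0: "T $ 0 = 0" by (simp add: T_def)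
  have Tp: "T ^ m = fps_const (s ^ m) * u ^ m" for m
    by (simp add: T_def u_def power_mult_distrib fps_const_power)
  have "A / B * ((fps_exp 1 oo T) - trunc_exp r T) = A / B * (T ^ Suc r * (G oo T))"
    using exp_compose_minus_trunc_exp[OF T0] by (simp add: G_def)
  also have "\<dots> = fps_const (s ^ Suc r) * (fps_const (1 / fact r) * (A / B * B) * (G oo T))"
    unfolding Tp uB by (simp only: mult_ac)
  also have "\<dots> = fps_const (s ^ Suc r) * (f 0 * (G oo T))"
    unfolding AB egf by simp
  finally have "(A / B * ((fps_exp 1 oo T) - trunc_exp r T)) $ n
      = s ^ Suc r * (\<Sum>m\<le>n. G $ m * (f 0 * T ^ m) $ n)"
    by (simp only: fps_mult_left_const_nth fps_mult_compose_nth[OF T0])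
  also have "\<dots> = (\<Sum>m\<le>n. s ^ Suc r * (1 / fact (Suc (r + m)) * (s ^ m * f m $ n)))"
  proof -
    \<comment> \<open>Up to a factor \<open>s\<close>, each \<open>T\<close> adds one more large
      member to the families counted.\<close>
    have "f 0 * T ^ m = fps_const (s ^ m) * f m" for m
      unfolding Tp egf by (simp add: mult_ac)
    then have "(f 0 * T ^ m) $ n = s ^ m * f m $ n" for m by simp
    then show ?thesis by (simp add: G_def sum_distrib_left del: power_Suc fact_Suc)
  qed
  also have "\<dots> = (\<Sum>m\<le>n. s ^ Suc (r + m) / fact (Suc (r + m)) * f m $ n)"
    by (intro sum.cong refl) (simp add: power_add del: fact_Suc)
  finally show ?thesis
    unfolding A_def B_def u_def f_def by (simp del: power_Suc fact_Suc)
qed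

theorem theorem5p2:
  fixes k l :: nat
  fixes x :: "nat \<Rightarrow> mpoly fract" and S :: "mpoly fract"
    and xy T :: "mpoly fract fps"
  assumes "k \<ge> 2" and "l \<ge> 1"
  defines "x \<equiv> \<lambda>i. to_fract (Var i)"
  defines "S \<equiv> (\<Sum>i=2..l. x i) + 1"
  defines "xy \<equiv> fps_const (x 1) * fps_X"
  defines "T \<equiv> fps_const (S / x 1) * (fps_exp (x 1) - 1)"
  shows "Abs_fps (\<lambda>n. if n \<ge> k
             then to_fract (exp_flag_poly l (Pi_polytope n k)) / fact n else 0) =
         fps_const (1 / S) *
           (\<Sum>i=0..k-1. xy ^ i * (fps_exp (x 1) - trunc_exp (k - i - 1) xy)
                / (fps_const (fact i) * (fps_exp (x 1) - 1) ^ (i + 1))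
              * ((fps_exp 1 oo T) - trunc_exp i T))"
proof (rule fps_ext, goal_cases)
  case (1 n)
  have x0: "x 1 \<noteq> 0" by (simp add: x_def Var_neq_0)
  have ivl: "{0..k-1} = {..<k}" using assms(1) by auto
  \<comment> \<open>The summation index of the statement is the number \<open>r\<close> of
    singletons, and the coefficients agree summand by summand.\<close>
  have "(if k \<le> n then to_fract (exp_flag_poly l (Pi_polytope n k)) / fact n else 0)
    = 1 / S * (\<Sum>r<k. \<Sum>m\<le>n. (S / x 1) ^ Suc (r + m) / fact (Suc (r + m)) *
        (of_nat (family_count k r m n) * x 1 ^ n / fact n))"
    using coeff_eq_family_count_sum[OF assms(1,2)] unfolding S_def x_def by blast
  also have "\<dots> = 1 / S * (\<Sum>r<k. (xy ^ r * (fps_exp (x 1) - trunc_exp (k - r - 1) xy)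
                / (fps_const (fact r) * (fps_exp (x 1) - 1) ^ (r + 1))
              * ((fps_exp 1 oo T) - trunc_exp r T)) $ n)"
    unfolding xy_def T_def
    by (intro arg_cong2[of _ _ _ _ "(*)"] sum.cong refl rhs_summand_nth[symmetric] x0) simp
  finally show ?case by (simp only: fps_nth_Abs_fps fps_mult_left_const_nth fps_sum_nth ivl)
qed

end
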